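(* Let $k\geqslant3$ be fixed, let $N$ range over primes tending to infinity, let $p=p_N\in[0,1]$, and let $\delta_N$ be a sequence satisfying \[ \max\left\{\frac{\log N}{p^{k-1}N},\ \frac{1}{\sqrt{pN}}\right\}\ll\delta_N\ll p^{k-2}. \] Then \[ \mathbb{P}\big(D^k(B_p)>\delta_N L^k(p)\big)=\exp\left(-(1+o(1))\frac{\delta_N^2\,pN}{2k^2(1-p)}\right), \] and the same asymptotic holds for $\mathbb{P}\big(D^k(B_p)<-\delta_N L^k(p)\big)$.
   Context: A $k$-progression in $\mathbb{Z}/N\mathbb{Z}$ ($N$ prime) is a set $\{x,x+d,\dots,x+(k-1)d\}$ with $x\in\mathbb{Z}/N\mathbb{Z}$, $d\in\{1,\dots,(N-1)/2\}$; there are $\binom{N}{2}$ of them. $B_p$ contains each element of $\mathbb{Z}/N\mathbb{Z}$ independently with probability $p$. $N^k(B_p)$ is the number of $k$-progressions contained in $B_p$, $L^k(p)=\mathbb{E}[N^k(B_p)]=p^k\binom{N}{2}$, and $D^k(B_p)=N^k(B_p)-L^k(p)$. $a_N\ll b_N$ means $a_N/b_N\to0$.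
   Formalization: The additional condition δ_N ≪ 1−p is assumed (automatic when p is bounded away from 1); without it the claim fails, e.g. for p = 1−1/N and δ_N = N^{-1/4} the upper-tail probability is 0, and at p = 1 the formula divides by zero. *)

theory Defs
  imports "HOL-Probability.Probability" "HOL-Computational_Algebra.Primes"
begin

text \<open>Asymptotics along \<open>N \<rightarrow> \<infinity>\<close> with \<open>N\<close> prime.\<close>

definition primes_at_top :: "nat filter" where
  "primes_at_top = inf at_top (principal {N. prime N})"

text \<open>
  The positivity condition is implicit in writing \<open>a\<^sub>N / b\<^sub>N \<rightarrow> 0\<close>.  It has to be explicit
  here: division by zero yields zero, so the limit alone would also hold for \<open>b = 0\<close>
  (e.g. for \<open>b\<^sub>N = p\<^sub>N ^ (k - 2)\<close> with \<open>p\<^sub>N = 0\<close>), and it does not fix the sign of \<open>b\<close>.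
\<close>

definition much_less :: "(nat \<Rightarrow> real) \<Rightarrow> (nat \<Rightarrow> real) \<Rightarrow> bool"  (infix \<open>\<lless>\<close> 50) where
  "a \<lless> b \<longleftrightarrow> (\<forall>\<^sub>F N in primes_at_top. b N > 0) \<and> ((\<lambda>N. a N / b N) \<longlongrightarrow> 0) primes_at_top"

text \<open>\<open>\<int>/N\<int>\<close> is represented by the residues \<open>{..<N}\<close>, with addition modulo \<open>N\<close>.\<close>

definition progression :: "nat \<Rightarrow> nat \<Rightarrow> nat \<Rightarrow> nat \<Rightarrow> nat set" where
  "progression k N x d = (\<lambda>i. (x + i * d) mod N) ` {..<k}"

definition progressions :: "nat \<Rightarrow> nat \<Rightarrow> nat set set" where
  "progressions k N = {progression k N x d | x d. x \<in> {..<N} \<and> d \<in> {1..(N - 1) div 2}}"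

definition random_subset :: "nat \<Rightarrow> real \<Rightarrow> nat set pmf" where
  "random_subset N p =
     map_pmf (\<lambda>f. {x \<in> {..<N}. f x}) (Pi_pmf {..<N} False (\<lambda>_. bernoulli_pmf p))"

definition prog_count :: "nat \<Rightarrow> nat \<Rightarrow> nat set \<Rightarrow> nat" where
  "prog_count k N B = card {P \<in> progressions k N. P \<subseteq> B}"

definition prog_mean :: "nat \<Rightarrow> nat \<Rightarrow> real \<Rightarrow> real" where
  "prog_mean k N p = measure_pmf.expectation (random_subset N p) (\<lambda>B. real (prog_count k N B))"

definition prog_dev :: "nat \<Rightarrow> nat \<Rightarrow> real \<Rightarrow> nat set \<Rightarrow> real" where
  "prog_dev k N p B = real (prog_count k N B) - prog_mean k N p"

end

theory Submission
  imports Defs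
begin

text \<open>
  Write \<open>Y\<^sub>x = 1[x \<in> B] - p\<close>.  Revealing the elements of \<open>B\<close> in increasing order turns the deviation
  \<open>D\<close> into a martingale \<open>\<Sum>x. Y\<^sub>x G\<^sub>x\<close>, where \<open>G\<^sub>x\<close> depends only on \<open>B \<inter> {..<x}\<close> and, since all points lie on
  equally many progressions, has a mean \<open>c\<close> independent of \<open>x\<close>.  Thus \<open>D = c \<Sum>x. Y\<^sub>x + R\<close> with
  \<open>R = \<Sum>x. Y\<^sub>x (G\<^sub>x - c)\<close>.

  The same expansion applied to \<open>G\<^sub>x\<close> has increments bounded by the codegree, at most \<open>k\<^sup>2\<close>, so all
  \<open>G\<^sub>x - c\<close> are \<open>o(c)\<close> outside an event of probability \<open>N exp (- \<Omega>(p ^ (2 k - 3) N))\<close>.  Feeding this into an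
  exponential martingale bound for \<open>R\<close> shows that \<open>R\<close> is negligible at the scale \<open>\<delta> L\<close>, even on
  the exponential scale.  What remains is the moderate deviation of the binomial variable \<open>|B|\<close>:
  Chernoff from above, exponential tilting and Chebyshev from below.
\<close>


section \<open>Expectations over a random subset\<close>

abbreviation (input) expect :: "nat \<Rightarrow> real \<Rightarrow> (nat set \<Rightarrow> real) \<Rightarrow> real" where
  "expect n p f \<equiv> measure_pmf.expectation (random_subset n p) f"

abbreviation (input) probab :: "nat \<Rightarrow> real \<Rightarrow> (nat set \<Rightarrow> bool) \<Rightarrow> real" where
  "probab n p P \<equiv> measure_pmf.prob (random_subset n p) {B. P B}"

lemma set_random_subset: "set_pmf (random_subset n p) \<subseteq> Pow {..<n}"
  by (auto simp: random_subset_def)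

lemma random_subset_subset: "B \<in> set_pmf (random_subset n p) \<Longrightarrow> B \<subseteq> {..<n}"
  using set_random_subset by blast

lemma integrable_random_subset [simp]:
  "integrable (random_subset n p) (f :: nat set \<Rightarrow> real)"
  by (rule integrable_measure_pmf_finite) (rule finite_subset[OF set_random_subset], simp)

lemma expect_cong:
  assumes "\<And>B. B \<subseteq> {..<n} \<Longrightarrow> f B = g B"
  shows "expect n p f = expect n p g"
  by (intro integral_cong_AE) (auto simp: AE_measure_pmf_iff intro!: assms dest: random_subset_subset)

lemma expect_mono:
  assumes "\<And>B. B \<subseteq> {..<n} \<Longrightarrow> f B \<le> g B"
  shows "expect n p f \<le> expect n p g"
  by (intro integral_mono_AE) (auto simp: AE_measure_pmf_iff intro!: assms dest: random_subset_subset)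

lemma random_subset_0: "random_subset 0 p = return_pmf {}"
  by (simp add: random_subset_def)

lemma random_subset_Suc:
  "random_subset (Suc n) p =
     bernoulli_pmf p \<bind> (\<lambda>b. map_pmf (\<lambda>B. if b then insert n B else B) (random_subset n p))"
  unfolding random_subset_def
  by (simp add: lessThan_Suc[of n] Pi_pmf_insert' map_bind_pmf pmf.map_comp o_def
           flip: map_pmf_def)
     (auto intro!: bind_pmf_cong pmf.map_cong0 split: if_splits)

lemma expect_0: "expect 0 p f = f {}"
  by (simp add: random_subset_0)

text \<open>Conditions on whether the largest element \<open>n\<close> is chosen. The inductions on
  \<open>n\<close> below run through this recursion, which does the work of conditional expectation
  given \<open>B \<inter> {..<n}\<close>.\<close>

lemma expect_Suc:
  assumes "0 \<le> p" "p \<le> 1"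
  shows "expect (Suc n) p f = expect n p (\<lambda>B. p * f (insert n B) + (1 - p) * f B)"
proof -
  have "expect (Suc n) p f =
    measure_pmf.expectation (bernoulli_pmf p) (\<lambda>b. expect n p (\<lambda>B. f (if b then insert n B else B)))"
    unfolding random_subset_Suc
    by (subst pmf_expectation_bind[where A = UNIV])
       (auto intro!: finite_subset[OF set_random_subset] simp: integral_measure_pmf[of UNIV])
  also have "\<dots> = p * expect n p (\<lambda>B. f (insert n B)) + (1 - p) * expect n p f"
    using assms by (simp add: mult.commute)
  finally show ?thesis by simp
qed

lemma probab_eq_expect: "probab n p P = expect n p (\<lambda>B. of_bool (P B))"
proof -
  have "(\<lambda>B. of_bool (P B)) = (indicator {B. P B} :: nat set \<Rightarrow> real)"
    by (auto simp: fun_eq_iff indicator_def)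
  then show ?thesis by simp
qed

lemma probab_mono:
  assumes "\<And>B. B \<subseteq> {..<n} \<Longrightarrow> P B \<Longrightarrow> Q B"
  shows "probab n p P \<le> probab n p Q"
  unfolding probab_eq_expect by (rule expect_mono) (use assms in auto)

lemma probab_disj: "probab n p (\<lambda>B. P B \<or> Q B) \<le> probab n p P + probab n p Q"
proof -
  have "expect n p (\<lambda>B. of_bool (P B \<or> Q B)) \<le> expect n p (\<lambda>B. of_bool (P B) + of_bool (Q B))"
    by (rule expect_mono) auto
  then show ?thesis unfolding probab_eq_expect by simp
qed

lemma probab_bex:
  assumes "finite X"
  shows "probab n p (\<lambda>B. \<exists>x\<in>X. P x B) \<le> (\<Sum>x\<in>X. probab n p (P x))"
  unfolding probab_eq_expect
proof (subst Bochner_Integration.integral_sum[symmetric], simp, rule expect_mono)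
  fix B
  show "of_bool (\<exists>x\<in>X. P x B) \<le> (\<Sum>x\<in>X. of_bool (P x B) :: real)"
  proof (cases "\<exists>x\<in>X. P x B")
    case True
    then obtain x where "x \<in> X" "P x B" by auto
    then show ?thesis
      using member_le_sum[of x X "\<lambda>x. of_bool (P x B) :: real"] assms by auto
  qed (auto intro!: sum_nonneg)
qed

section \<open>Predictable transforms of the centred indicators\<close>

definition centred :: "real \<Rightarrow> nat \<Rightarrow> nat set \<Rightarrow> real" where
  "centred p x B = of_bool (x \<in> B) - p"

text \<open>
  The intersection with \<open>{..<x}\<close> makes the coefficients predictable; the constant coefficient \<open>1\<close>
  gives the centred binomial variable \<open>|B| - p n\<close>.
\<close>

definition transform :: "real \<Rightarrow> (nat \<Rightarrow> nat set \<Rightarrow> real) \<Rightarrow> nat \<Rightarrow> nat set \<Rightarrow> real" where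
  "transform p h n B = (\<Sum>x<n. centred p x B * h x (B \<inter> {..<x}))"

lemma transform_0 [simp]: "transform p h 0 B = 0"
  by (simp add: transform_def)

lemma transform_Suc_insert:
  assumes "B \<subseteq> {..<n}"
  shows "transform p h (Suc n) (insert n B) = transform p h n B + (1 - p) * h n B"
proof -
  have "transform p h n (insert n B) = transform p h n B"
    unfolding transform_def
    by (intro sum.cong refl arg_cong2[where f = "(*)"] arg_cong[where f = "h _"])
       (auto simp: centred_def)
  moreover have "insert n B \<inter> {..<n} = B" using assms by auto
  ultimately show ?thesis by (simp add: transform_def centred_def)
qed

lemma transform_Suc:
  assumes "B \<subseteq> {..<n}"
  shows "transform p h (Suc n) B = transform p h n B - p * h n B"
proof -
  have "B \<inter> {..<n} = B" "n \<notin> B" using assms by auto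
  then show ?thesis by (simp add: transform_def centred_def)
qed

text \<open>Given the earlier elements, step \<open>n\<close> contributes
  \<open>p * (1 - p) * h n B\<close> and \<open>- (1 - p) * p * h n B\<close>, which cancel because
  \<open>h n B\<close> is already determined.\<close>

lemma expect_transform:
  assumes "0 \<le> p" "p \<le> 1"
  shows "expect n p (transform p h n) = 0"
proof (induction n)
  case (Suc n)
  have "expect (Suc n) p (transform p h (Suc n)) = expect n p (transform p h n)"
    unfolding expect_Suc[OF assms]
    by (rule expect_cong) (simp add: transform_Suc_insert transform_Suc algebra_simps)
  then show ?case using Suc by simp
qed (simp add: expect_0)

section \<open>Exponential moments and tail bounds\<close>

text \<open>Taylor's formula with Lagrange remainder. The two bounds agree to second order as
  \<open>z\<close> tends to 0, which later yields matching constants in the exponent.\<close>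

lemma exp_second_order:
  fixes z :: real
  shows exp_second_order_upper: "exp z \<le> 1 + z + z\<^sup>2 / 2 * exp \<bar>z\<bar>"
    and exp_second_order_lower: "1 + z + z\<^sup>2 / 2 * exp (- \<bar>z\<bar>) \<le> exp z"
proof -
  obtain t where t: "\<bar>t\<bar> \<le> \<bar>z\<bar>" "exp z = (\<Sum>m<2. (z ^ m) / fact m) + (exp t / fact 2) * z ^ 2"
    using Maclaurin_exp_le by blast
  then have eq: "exp z = 1 + z + z\<^sup>2 / 2 * exp t"
    by (simp add: numeral_2_eq_2)
  have "exp t \<le> exp \<bar>z\<bar>" "exp (- \<bar>z\<bar>) \<le> exp t" using t(1) by auto
  then show "exp z \<le> 1 + z + z\<^sup>2 / 2 * exp \<bar>z\<bar>" "1 + z + z\<^sup>2 / 2 * exp (- \<bar>z\<bar>) \<le> exp z"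
    unfolding eq by (auto intro!: mult_left_mono)
qed

text \<open>Moment generating function at \<open>u\<close> of a Bernoulli variable centred at its
  mean \<open>p\<close>.\<close>

definition bernoulli_mgf :: "real \<Rightarrow> real \<Rightarrow> real" where
  "bernoulli_mgf p u = p * exp (u * (1 - p)) + (1 - p) * exp (- u * p)"

text \<open>Both exponents have absolute value at most \<open>\<bar>u\<bar>\<close>. After expansion
  the linear terms cancel by centring and the quadratic ones add up to the variance
  \<open>p * (1 - p)\<close>.\<close>

lemma bernoulli_mgf_upper:
  assumes "0 \<le> p" "p \<le> 1"
  shows "bernoulli_mgf p u \<le> exp (u\<^sup>2 * (p * (1 - p)) * exp \<bar>u\<bar> / 2)"
proof -
  have *: "exp z \<le> 1 + z + z\<^sup>2 / 2 * exp \<bar>u\<bar>" if "\<bar>z\<bar> \<le> \<bar>u\<bar>" for z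
    using exp_second_order_upper[of z] mult_left_mono[of "exp \<bar>z\<bar>" "exp \<bar>u\<bar>" "z\<^sup>2 / 2"] that by auto
  have "\<bar>u * (1 - p)\<bar> \<le> \<bar>u\<bar>" "\<bar>- u * p\<bar> \<le> \<bar>u\<bar>"
    using assms by (auto simp: abs_mult mult_left_le)
  then have "bernoulli_mgf p u \<le> p * (1 + u * (1 - p) + (u * (1 - p))\<^sup>2 / 2 * exp \<bar>u\<bar>)
     + (1 - p) * (1 + (- u * p) + (- u * p)\<^sup>2 / 2 * exp \<bar>u\<bar>)"
    unfolding bernoulli_mgf_def using assms by (intro add_mono mult_left_mono *) auto
  also have "\<dots> = 1 + u\<^sup>2 * (p * (1 - p)) * exp \<bar>u\<bar> / 2"
    by (simp add: field_simps power2_eq_square)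
  also have "\<dots> \<le> exp (u\<^sup>2 * (p * (1 - p)) * exp \<bar>u\<bar> / 2)"
    by (rule exp_ge_add_one_self)
  finally show ?thesis .
qed

lemma bernoulli_mgf_lower:
  assumes "0 \<le> p" "p \<le> 1"
  shows "1 + u\<^sup>2 * (p * (1 - p)) * exp (- \<bar>u\<bar>) / 2 \<le> bernoulli_mgf p u"
proof -
  have *: "1 + z + z\<^sup>2 / 2 * exp (- \<bar>u\<bar>) \<le> exp z" if "\<bar>z\<bar> \<le> \<bar>u\<bar>" for z
    using exp_second_order_lower[of z] mult_left_mono[of "exp (-\<bar>u\<bar>)" "exp (-\<bar>z\<bar>)" "z\<^sup>2 / 2"] that by auto
  have "1 + u\<^sup>2 * (p * (1 - p)) * exp (- \<bar>u\<bar>) / 2 =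
     p * (1 + u * (1 - p) + (u * (1 - p))\<^sup>2 / 2 * exp (- \<bar>u\<bar>))
     + (1 - p) * (1 + (- u * p) + (- u * p)\<^sup>2 / 2 * exp (- \<bar>u\<bar>))"
    by (simp add: field_simps power2_eq_square)
  also have "\<bar>u * (1 - p)\<bar> \<le> \<bar>u\<bar>" "\<bar>- u * p\<bar> \<le> \<bar>u\<bar>"
    using assms by (auto simp: abs_mult mult_left_le)
  then have "p * (1 + u * (1 - p) + (u * (1 - p))\<^sup>2 / 2 * exp (- \<bar>u\<bar>))
     + (1 - p) * (1 + (- u * p) + (- u * p)\<^sup>2 / 2 * exp (- \<bar>u\<bar>)) \<le> bernoulli_mgf p u"
    unfolding bernoulli_mgf_def using assms by (intro add_mono mult_left_mono *) auto
  finally show ?thesis .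
qed

text \<open>Conditionally on the past, step \<open>n\<close> multiplies the exponential moment by
  \<open>bernoulli_mgf p (l * h n B)\<close>, bounded uniformly in \<open>B\<close>. Unlike in
  Azuma's inequality, the variance factor \<open>p * (1 - p)\<close> is kept; for small
  \<open>p\<close> this is what gives the right exponent.\<close>

lemma transform_mgf:
  assumes p: "0 \<le> p" "p \<le> 1" and h: "\<And>x C. x < n \<Longrightarrow> \<bar>h x C\<bar> \<le> t" and "0 \<le> t"
  shows "expect n p (\<lambda>B. exp (l * transform p h n B)) \<le>
     exp (real n * ((l * t)\<^sup>2 * (p * (1 - p)) * exp \<bar>l * t\<bar> / 2))"
  using h
proof (induction n)
  case 0
  then show ?case by (simp add: expect_0)
next
  case (Suc n)
  define v where "v = (l * t)\<^sup>2 * (p * (1 - p)) * exp \<bar>l * t\<bar> / 2"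
  have step: "bernoulli_mgf p (l * h n B) \<le> exp v" for B
  proof -
    have le: "\<bar>l * h n B\<bar> \<le> \<bar>l * t\<bar>"
      using Suc.prems[of n B] \<open>0 \<le> t\<close> by (auto simp: abs_mult intro!: mult_left_mono)
    then have "(l * h n B)\<^sup>2 \<le> (l * t)\<^sup>2" by (simp add: abs_le_square_iff)
    then have "(l * h n B)\<^sup>2 * (p * (1 - p)) * exp \<bar>l * h n B\<bar> / 2 \<le> v"
      unfolding v_def using p le by (intro divide_right_mono mult_mono) auto
    then show ?thesis
      using bernoulli_mgf_upper[OF p, of "l * h n B"] by (meson exp_le_cancel_iff order_trans)
  qed
  have "expect (Suc n) p (\<lambda>B. exp (l * transform p h (Suc n) B)) =
    expect n p (\<lambda>B. exp (l * transform p h n B) * bernoulli_mgf p (l * h n B))"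
    unfolding expect_Suc[OF p]
    by (rule expect_cong)
       (simp add: transform_Suc_insert transform_Suc bernoulli_mgf_def algebra_simps flip: exp_add)
  also have "\<dots> \<le> expect n p (\<lambda>B. exp (l * transform p h n B) * exp v)"
    by (rule expect_mono) (simp add: step)
  also have "\<dots> \<le> exp (real n * v) * exp v"
    using Suc unfolding v_def by simp
  also have "\<dots> = exp (real (Suc n) * v)"
    by (simp add: algebra_simps flip: exp_add)
  finally show ?case unfolding v_def .
qed

text \<open>Exponential Markov inequality. The parameter \<open>l\<close> stays free, since each
  application balances the two terms of the exponent differently.\<close>

lemma transform_upper_tail:
  assumes p: "0 \<le> p" "p \<le> 1" and h: "\<And>x C. x < n \<Longrightarrow> \<bar>h x C\<bar> \<le> t" and "0 \<le> t" "0 \<le> l"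
  shows "probab n p (\<lambda>B. transform p h n B \<ge> a) \<le>
     exp (real n * ((l * t)\<^sup>2 * (p * (1 - p)) * exp (l * t) / 2) - l * a)"
proof -
  have "probab n p (\<lambda>B. transform p h n B \<ge> a) \<le>
        expect n p (\<lambda>B. exp (l * transform p h n B) * exp (- l * a))"
    unfolding probab_eq_expect
    by (rule expect_mono) (use \<open>0 \<le> l\<close> in \<open>auto simp: mult_left_mono simp flip: exp_add\<close>)
  also have "\<dots> \<le> exp (real n * ((l * t)\<^sup>2 * (p * (1 - p)) * exp \<bar>l * t\<bar> / 2)) * exp (- l * a)"
    using transform_mgf[OF p _ \<open>0 \<le> t\<close>, of n h l] h by simp
  finally show ?thesis using assms by (simp flip: exp_add)
qed

lemma transform_uminus: "transform p (\<lambda>x C. - h x C) n B = - transform p h n B"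
  by (simp add: transform_def sum_negf)

lemma transform_abs_tail:
  assumes p: "0 \<le> p" "p \<le> 1" and h: "\<And>x C. x < n \<Longrightarrow> \<bar>h x C\<bar> \<le> t" and "0 \<le> t" "0 \<le> l"
  shows "probab n p (\<lambda>B. \<bar>transform p h n B\<bar> \<ge> a) \<le>
     2 * exp (real n * ((l * t)\<^sup>2 * (p * (1 - p)) * exp (l * t) / 2) - l * a)"
proof -
  have "probab n p (\<lambda>B. \<bar>transform p h n B\<bar> \<ge> a) \<le>
    probab n p (\<lambda>B. transform p h n B \<ge> a \<or> transform p (\<lambda>x C. - h x C) n B \<ge> a)"
    by (rule probab_mono) (auto simp: transform_uminus)
  also have "\<dots> \<le> probab n p (\<lambda>B. transform p h n B \<ge> a)
      + probab n p (\<lambda>B. transform p (\<lambda>x C. - h x C) n B \<ge> a)"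
    by (rule probab_disj)
  finally show ?thesis
    using transform_upper_tail[OF p, of n h t l a]
      transform_upper_tail[OF p, of n "\<lambda>x C. - h x C" t l a] assms by simp
qed

text \<open>Doob decomposition of an indicator: the conditional probability of
  \<open>A \<subseteq> B\<close> is followed while elements are revealed in increasing order, and it
  changes only at points of \<open>A\<close>.\<close>

lemma subset_indicator_expansion:
  assumes "A \<subseteq> {..<n}"
  shows "of_bool (A \<subseteq> B) - p ^ card A =
    (\<Sum>x<n. centred p x B * (of_bool (x \<in> A) * p ^ card (A \<inter> {x<..}) * of_bool (A \<inter> {..<x} \<subseteq> B)))"
proof -
  \<comment> \<open>Points of \<open>A\<close> below \<open>m\<close> are already decided; each of
    the others still contributes a factor \<open>p\<close>.\<close>
  define \<phi> where "\<phi> m = of_bool (A \<inter> {..<m} \<subseteq> B) * p ^ card (A \<inter> {m..})" for m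
  have fin: "finite A" using assms finite_subset by blast
  have step: "\<phi> (Suc x) - \<phi> x =
    centred p x B * (of_bool (x \<in> A) * p ^ card (A \<inter> {x<..}) * of_bool (A \<inter> {..<x} \<subseteq> B))" for x
  proof (cases "x \<in> A")
    case True
    have "A \<inter> {x..} = insert x (A \<inter> {x<..})" "A \<inter> {Suc x..} = A \<inter> {x<..}"
      "A \<inter> {..<Suc x} = insert x (A \<inter> {..<x})"
      using True by auto
    then show ?thesis using True fin by (auto simp: \<phi>_def centred_def algebra_simps)
  next
    case False
    have "A \<inter> {Suc x..} = A \<inter> {x..}" "A \<inter> {..<Suc x} = A \<inter> {..<x}"
      using False by (auto simp: less_Suc_eq order_le_less Suc_le_eq)
    then show ?thesis using False by (simp add: \<phi>_def)
  qed
  have "A \<inter> {..<n} = A" "A \<inter> {n..} = {}" using assms by auto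
  then have "of_bool (A \<subseteq> B) - p ^ card A = \<phi> n - \<phi> 0"
    by (simp add: \<phi>_def atLeast_0)
  also have "\<dots> = (\<Sum>x<n. \<phi> (Suc x) - \<phi> x)" by (rule sum_lessThan_telescope[symmetric])
  finally show ?thesis by (simp add: step)
qed


section \<open>Progressions modulo a prime\<close>

text \<open>The point 0 represents all points: by translation every residue has this degree, as
  \<open>degree_eq\<close> shows.\<close>

definition prog_degree :: "nat \<Rightarrow> nat \<Rightarrow> nat" where
  "prog_degree k N = card {P \<in> progressions k N. 0 \<in> P}"

lemma mod_eq_iff_int_dvd: "a mod N = b mod N \<longleftrightarrow> int N dvd int a - int b"
  by (metis mod_eq_dvd_iff of_nat_eq_iff of_nat_mod)

lemma eq_if_dvd_diff:
  assumes "int N dvd int a - int b" "a < N" "b < N"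
  shows "a = b"
  using assms by (metis mod_eq_iff_int_dvd mod_less)

lemma prime_dvd_diff_mult_cancel:
  assumes "prime N" "int N dvd (int i - int j) * c" "i < N" "j < N" "i \<noteq> j"
  shows "int N dvd c"
proof -
  have "prime (int N)" using assms(1) by simp
  then have "int N dvd int i - int j \<or> int N dvd c"
    using assms(2) by (simp add: prime_dvd_mult_iff)
  then show ?thesis using eq_if_dvd_diff assms(3-5) by blast
qed

lemma progression_subset: "0 < N \<Longrightarrow> progression k N x d \<subseteq> {..<N}"
  by (auto simp: progression_def)

lemma progressions_subset: "0 < N \<Longrightarrow> P \<in> progressions k N \<Longrightarrow> P \<subseteq> {..<N}"
  using progression_subset[of N k] by (auto simp: progressions_def)

lemma finite_progressions [simp]: "finite (progressions k N)"
proof -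
  have "progressions k N \<subseteq> (\<lambda>(x, d). progression k N x d) ` ({..<N} \<times> {1..(N - 1) div 2})"
    by (auto simp: progressions_def)
  then show ?thesis by (rule finite_subset) simp
qed

lemma progressionsE:
  assumes "P \<in> progressions k N"
  obtains x d where "P = progression k N x d" "x < N" "1 \<le> d" "d \<le> (N - 1) div 2"
  using assms unfolding progressions_def by auto

lemma card_progression:
  assumes "prime N" "k \<le> N" "P \<in> progressions k N"
  shows "card P = k"
proof -
  obtain x d where P: "P = progression k N x d" and d: "1 \<le> d" "d \<le> (N - 1) div 2"
    using assms(3) by (blast elim: progressionsE)
  have "d < N" using d by linarith
  have "inj_on (\<lambda>i. (x + i * d) mod N) {..<k}"
  proof (rule inj_onI, rule ccontr)
    fix i j assume ij: "i \<in> {..<k}" "j \<in> {..<k}" "(x + i * d) mod N = (x + j * d) mod N" "i \<noteq> j"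
    then have "int N dvd (int i - int j) * int d"
      by (simp add: mod_eq_iff_int_dvd algebra_simps)
    then have "int N dvd int d"
      using prime_dvd_diff_mult_cancel assms(1,2) ij by (metis lessThan_iff order_less_le_trans)
    then show False using d \<open>d < N\<close> by (simp add: nat_dvd_not_less)
  qed
  then show ?thesis by (simp add: P progression_def card_image)
qed

text \<open>The positions \<open>i \<noteq> j\<close> of \<open>x\<close> and \<open>y\<close>
  determine the progression: subtracting the two congruences gives \<open>d\<close> modulo the prime
  \<open>N\<close>, and then the starting point. So progressions inject into pairs of
  positions.\<close>

lemma codegree_le:
  assumes "prime N" "k \<le> N" "x \<noteq> y"
  shows "card {P \<in> progressions k N. x \<in> P \<and> y \<in> P} \<le> k\<^sup>2"
proof -
  let ?A = "{P \<in> progressions k N. x \<in> P \<and> y \<in> P}"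
  define R where "R P = (\<lambda>(i, j). i < k \<and> j < k \<and> (\<exists>z d. z < N \<and> d < N \<and> P = progression k N z d \<and>
      x = (z + i * d) mod N \<and> y = (z + j * d) mod N))" for P
  have ex: "\<exists>ij. R P ij" if P: "P \<in> ?A" for P
  proof -
    obtain z d where 1: "P = progression k N z d" "z < N" "1 \<le> d" "d \<le> (N - 1) div 2"
      using P by (blast elim: progressionsE)
    have "d < N" using 1(3,4) by linarith
    have "x \<in> progression k N z d" "y \<in> progression k N z d" using P 1(1) by simp_all
    then obtain i j where "i < k" "x = (z + i * d) mod N" "j < k" "y = (z + j * d) mod N"
      unfolding progression_def by blast
    with 1 \<open>d < N\<close> have "R P (i, j)" unfolding R_def by blast
    then show ?thesis ..
  qed
  have uniq: "P = P'" if R: "R P (i, j)" "R P' (i, j)" for P P' i j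
  proof -
    obtain z d where 1: "z < N" "d < N" "P = progression k N z d"
      "x = (z + i * d) mod N" "y = (z + j * d) mod N" and "i < k" "j < k"
      using R(1) unfolding R_def by blast
    obtain z' d' where 2: "z' < N" "d' < N" "P' = progression k N z' d'"
      "x = (z' + i * d') mod N" "y = (z' + j * d') mod N"
      using R(2) unfolding R_def by blast
    have "i \<noteq> j" using 1(4,5) assms(3) by blast
    have dx: "int N dvd int (z + i * d) - int (z' + i * d')"
      and dy: "int N dvd int (z + j * d) - int (z' + j * d')"
      unfolding mod_eq_iff_int_dvd[symmetric] using 1(4,5) 2(4,5) by metis+
    have "int N dvd (int i - int j) * (int d - int d')"
      using dvd_diff[OF dx dy] by (simp add: algebra_simps)
    then have "int N dvd int d - int d'"
      by (rule prime_dvd_diff_mult_cancel[OF assms(1)]) (use \<open>i < k\<close> \<open>j < k\<close> \<open>i \<noteq> j\<close> assms(2) in auto)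
    then have "d = d'" using 1(2) 2(2) by (rule eq_if_dvd_diff)
    moreover from this have "int N dvd int z - int z'" using dx by simp
    then have "z = z'" using 1(1) 2(1) by (rule eq_if_dvd_diff)
    ultimately show ?thesis using 1(3) 2(3) by simp
  qed
  \<comment> \<open>A progression may have several representations, hence several pairs in
    \<open>R P\<close>; one is selected, and \<open>uniq\<close> makes the selection
    injective.\<close>
  define f where "f P = (SOME ij. R P ij)" for P
  have f: "R P (f P)" if "P \<in> ?A" for P
    unfolding f_def using ex[OF that] by (rule someI_ex)
  have "inj_on f ?A"
  proof (rule inj_onI)
    fix P P' assume "P \<in> ?A" "P' \<in> ?A" "f P = f P'"
    then show "P = P'" using f[of P] f[of P'] uniq[of P "fst (f P)" "snd (f P)" P'] by simp
  qed
  moreover have "f ` ?A \<subseteq> {..<k} \<times> {..<k}"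
  proof
    fix ij assume "ij \<in> f ` ?A"
    then obtain P where "R P ij" using f by blast
    then show "ij \<in> {..<k} \<times> {..<k}" by (auto simp: R_def)
  qed
  ultimately have "card ?A \<le> card ({..<k} \<times> {..<k})"
    by (intro card_inj_on_le) auto
  then show ?thesis by (simp add: power2_eq_square)
qed

text \<open>Translation by \<open>t\<close> permutes the residues and keeps the common difference,
  so it injects the progressions through \<open>x\<close> into those through the translate.\<close>

lemma degree_translate_le:
  assumes "0 < N"
  shows "card {P \<in> progressions k N. x \<in> P} \<le> card {P \<in> progressions k N. (x + t) mod N \<in> P}"
proof (rule card_inj_on_le)
  let ?s = "\<lambda>y. (y + t) mod N"
  have "inj_on ?s {..<N}"
    by (rule inj_onI) (auto simp: mod_eq_iff_int_dvd intro: eq_if_dvd_diff)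
  then have "inj_on ((`) ?s) (Pow {..<N})" by (rule inj_on_image_Pow)
  then show "inj_on ((`) ?s) {P \<in> progressions k N. x \<in> P}"
    by (rule inj_on_subset) (use progressions_subset[OF assms] in auto)
  have "?s ` progression k N z d = progression k N (?s z) d" for z d
    by (auto simp: progression_def image_image mod_simps add_ac intro!: image_cong)
  then have "?s ` P \<in> progressions k N" if "P \<in> progressions k N" for P
    using that assms by (fastforce simp: progressions_def)
  then show "(`) ?s ` {P \<in> progressions k N. x \<in> P} \<subseteq> {P \<in> progressions k N. ?s x \<in> P}"
    by auto
qed simp

lemma degree_eq:
  assumes "x < N"
  shows "card {P \<in> progressions k N. x \<in> P} = prog_degree k N"
proof (rule antisym)
  have "(x + (N - x)) mod N = 0" "(0 + x) mod N = x" using assms by auto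
  then show "card {P \<in> progressions k N. x \<in> P} \<le> prog_degree k N"
    and "prog_degree k N \<le> card {P \<in> progressions k N. x \<in> P}"
    using degree_translate_le[of N k x "N - x"] degree_translate_le[of N k 0 x] assms
    by (auto simp: prog_degree_def)
qed

lemma degree_double_count:
  assumes "prime N" "k \<le> N"
  shows "N * prog_degree k N = k * card (progressions k N)"
proof -
  have pos: "0 < N" using assms(1) prime_gt_0_nat by blast
  have "N * prog_degree k N = (\<Sum>x<N. card {P \<in> progressions k N. x \<in> P})"
    by (simp add: degree_eq)
  also have "\<dots> = (\<Sum>x<N. \<Sum>P\<in>progressions k N. of_bool (x \<in> P))"
    by (simp add: sum.If_cases of_bool_def Int_def)
  also have "\<dots> = (\<Sum>P\<in>progressions k N. \<Sum>x<N. of_bool (x \<in> P))"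
    by (rule sum.swap)
  also have "\<dots> = (\<Sum>P\<in>progressions k N. card P)"
  proof (rule sum.cong)
    fix P assume "P \<in> progressions k N"
    then have "{..<N} \<inter> P = P" using progressions_subset[OF pos] by auto
    then show "(\<Sum>x<N. of_bool (x \<in> P)) = card P"
      by (simp add: sum.If_cases of_bool_def)
  qed simp
  also have "\<dots> = k * card (progressions k N)"
    using card_progression[OF assms] by simp
  finally show ?thesis .
qed

text \<open>As \<open>N\<close> is odd, one of \<open>y - x\<close> and \<open>N - (y - x)\<close>
  is an admissible difference. The two points are then the first two terms of a progression starting
  at \<open>x\<close>, or at \<open>y\<close> with wraparound.\<close>

lemma progression_through_pair:
  assumes "odd N" "2 \<le> k" "x < y" "y < N"
  shows "\<exists>P\<in>progressions k N. x \<in> P \<and> y \<in> P"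
proof -
  have mem: "z mod N \<in> progression k N z d" "(z + d) mod N \<in> progression k N z d" for z d
    using assms(2) by (auto simp: progression_def intro: image_eqI[of _ _ 0] image_eqI[of _ _ 1])
  show ?thesis
  proof (cases "y - x \<le> (N - 1) div 2")
    case True
    then have "progression k N x (y - x) \<in> progressions k N"
      unfolding progressions_def using assms
      by (intro CollectI exI[of _ x] exI[of _ "y - x"]) auto
    moreover have "x \<in> progression k N x (y - x)" "y \<in> progression k N x (y - x)"
      using mem[of x "y - x"] assms by auto
    ultimately show ?thesis by blast
  next
    case False
    define d where "d = N - (y - x)"
    obtain m where "N = 2 * m + 1" using \<open>odd N\<close> by (rule oddE)
    then have "1 \<le> d" "d \<le> (N - 1) div 2" using False assms(3,4) unfolding d_def by auto
    then have "progression k N y d \<in> progressions k N"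
      unfolding progressions_def using assms by (intro CollectI exI[of _ y] exI[of _ d]) auto
    moreover have "(y + d) mod N = x" using assms by (simp add: d_def)
    then have "x \<in> progression k N y d" "y \<in> progression k N y d"
      using mem[of y d] assms by auto
    ultimately show ?thesis by blast
  qed
qed

text \<open>The progressions through 0 cover all nonzero residues, and each covers only
  \<open>k\<close> points.\<close>

lemma degree_lower_bound:
  assumes "prime N" "2 < N" "k \<le> N" "2 \<le> k"
  shows "N - 1 \<le> k * prog_degree k N"
proof -
  have pos: "0 < N" and odd: "odd N" using assms prime_odd_nat by auto
  let ?A = "{P \<in> progressions k N. 0 \<in> P}"
  have "{1..<N} \<subseteq> \<Union> ?A"
  proof
    fix y assume "y \<in> {1..<N}"
    then obtain P where "P \<in> progressions k N" "0 \<in> P" "y \<in> P"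
      using progression_through_pair[OF odd assms(4), of 0 y] by auto
    then show "y \<in> \<Union> ?A" by blast
  qed
  moreover have "finite (\<Union> ?A)"
  proof (rule finite_subset)
    show "\<Union> ?A \<subseteq> {..<N}" using progressions_subset[OF pos] by blast
  qed simp
  ultimately have "card {1..<N} \<le> card (\<Union> ?A)" by (intro card_mono)
  also have "\<dots> \<le> (\<Sum>P\<in>?A. card P)" by (rule card_Union_le_sum_card)
  also have "\<dots> = k * prog_degree k N"
    using card_progression[OF assms(1,3)] by (simp add: prog_degree_def)
  finally show ?thesis by simp
qed


section \<open>Decomposition of the progression count\<close>

text \<open>With \<open>C = B \<inter> {..<x}\<close> this is the conditional expectation, given
  \<open>C\<close>, of the number of progressions through \<open>x\<close> whose other points all
  lie in \<open>B\<close>.\<close>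

definition link_sum :: "nat \<Rightarrow> nat \<Rightarrow> real \<Rightarrow> nat \<Rightarrow> nat set \<Rightarrow> real" where
  "link_sum k N p x C =
     (\<Sum>P\<in>{P \<in> progressions k N. x \<in> P}. p ^ card (P \<inter> {x<..}) * of_bool (P \<inter> {..<x} \<subseteq> C))"

text \<open>
  The mean of each \<open>link_sum k N p x\<close>, by regularity of the progression hypergraph.
\<close>

definition link_mean :: "nat \<Rightarrow> nat \<Rightarrow> real \<Rightarrow> real" where
  "link_mean k N p = real (prog_degree k N) * p ^ (k - 1)"

text \<open>Expand the indicator of each progression by \<open>subset_indicator_expansion\<close>,
  then collect the terms according to the revealed point \<open>x\<close>.\<close>

lemma prog_count_centred:
  assumes "prime N" "k \<le> N"
  shows "real (prog_count k N B) - p ^ k * real (card (progressions k N)) =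
    transform p (link_sum k N p) N B"
proof -
  have pos: "0 < N" using assms(1) prime_gt_0_nat by blast
  have "real (prog_count k N B) - p ^ k * real (card (progressions k N)) =
    (\<Sum>P\<in>progressions k N. of_bool (P \<subseteq> B) - p ^ card P)"
    using card_progression[OF assms]
    by (simp add: prog_count_def sum_subtractf sum.If_cases of_bool_def Int_def)
  also have "\<dots> = (\<Sum>P\<in>progressions k N. \<Sum>x<N. centred p x B *
      (of_bool (x \<in> P) * p ^ card (P \<inter> {x<..}) * of_bool (P \<inter> {..<x} \<subseteq> B)))"
    by (intro sum.cong refl subset_indicator_expansion progressions_subset[OF pos])
  also have "\<dots> = (\<Sum>x<N. \<Sum>P\<in>progressions k N. centred p x B *
      (of_bool (x \<in> P) * p ^ card (P \<inter> {x<..}) * of_bool (P \<inter> {..<x} \<subseteq> B)))"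
    by (rule sum.swap)
  also have "\<dots> = transform p (link_sum k N p) N B"
    unfolding transform_def link_sum_def sum_distrib_left
    by (intro sum.cong refl sum.mono_neutral_cong_right) auto
  finally show ?thesis .
qed

lemma prog_mean_eq:
  assumes "prime N" "k \<le> N" "0 \<le> p" "p \<le> 1"
  shows "prog_mean k N p = p ^ k * real (card (progressions k N))"
proof -
  have "expect N p (\<lambda>B. real (prog_count k N B) - p ^ k * real (card (progressions k N))) = 0"
    unfolding prog_count_centred[OF assms(1,2)] by (rule expect_transform[OF assms(3,4)])
  then show ?thesis by (simp add: prog_mean_def)
qed

text \<open>Fixes the scale: a deviation \<open>\<delta> * prog_mean\<close> of the count
  corresponds, through the factor \<open>link_mean\<close>, to a deviation
  \<open>\<delta> * p * N / k\<close> of the size of \<open>B\<close>.\<close>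

lemma prog_mean_eq_link_mean:
  assumes "prime N" "1 \<le> k" "k \<le> N" "0 \<le> p" "p \<le> 1"
  shows "prog_mean k N p = link_mean k N p * (p * real N / real k)"
proof -
  have "real N * real (prog_degree k N) = real k * real (card (progressions k N))"
    using degree_double_count[OF assms(1,3)] by (simp flip: of_nat_mult)
  then have "real (card (progressions k N)) = real N * real (prog_degree k N) / real k"
    using assms(2) by (simp add: field_simps)
  moreover have "p ^ k = p * p ^ (k - 1)" using assms(2) by (metis One_nat_def Suc_le_D diff_Suc_1 power_Suc)
  ultimately show ?thesis
    using prog_mean_eq[OF assms(1,3-5)] by (simp add: link_mean_def)
qed

definition remainder :: "nat \<Rightarrow> nat \<Rightarrow> real \<Rightarrow> nat set \<Rightarrow> real" where
  "remainder k N p B = transform p (\<lambda>x C. link_sum k N p x C - link_mean k N p) N B"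

lemma prog_dev_eq:
  assumes "prime N" "k \<le> N" "0 \<le> p" "p \<le> 1"
  shows "prog_dev k N p B = link_mean k N p * transform p (\<lambda>_ _. 1) N B + remainder k N p B"
proof -
  have "prog_dev k N p B = transform p (link_sum k N p) N B"
    unfolding prog_dev_def prog_mean_eq[OF assms] by (rule prog_count_centred[OF assms(1,2)])
  also have "\<dots> = link_mean k N p * transform p (\<lambda>_ _. 1) N B + remainder k N p B"
    unfolding remainder_def transform_def sum_distrib_left sum.distrib[symmetric]
    by (intro sum.cong refl) (simp add: algebra_simps)
  finally show ?thesis .
qed

section \<open>Tail bound for the remainder\<close>

text \<open>For fixed \<open>x\<close> the deviation of \<open>link_sum\<close> is again a
  transform. Its coefficient at \<open>y\<close> is a weighted count, with weights at most 1, of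
  progressions through both \<open>x\<close> and \<open>y\<close>, hence at most the
  codegree.\<close>

lemma link_sum_tail:
  assumes N: "prime N" "k \<le> N" and x: "x < N" and p: "0 \<le> p" "p \<le> 1" and "0 \<le> l"
  shows "probab N p (\<lambda>B. \<bar>link_sum k N p x (B \<inter> {..<x}) - link_mean k N p\<bar> \<ge> a) \<le>
    2 * exp (real N * ((l * (real k)\<^sup>2)\<^sup>2 * (p * (1 - p)) * exp (l * (real k)\<^sup>2) / 2) - l * a)"
proof -
  have pos: "0 < N" using x by simp
  let ?Q = "{P \<in> progressions k N. x \<in> P}"
  define g where "g P = P \<inter> {..<x}" for P :: "nat set"
  define h where "h y C = (\<Sum>P\<in>?Q. p ^ card (P \<inter> {x<..}) *
     (of_bool (y \<in> g P) * p ^ card (g P \<inter> {y<..}) * of_bool (g P \<inter> {..<y} \<subseteq> C)))" for y C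
  \<comment> \<open>The \<open>k - 1\<close> points of \<open>P\<close> other than \<open>x\<close>
    lie either above or below \<open>x\<close>.\<close>
  have split: "p ^ (k - 1) = p ^ card (P \<inter> {x<..}) * p ^ card (g P)" if "P \<in> ?Q" for P
  proof -
    have fin: "finite P" using that progressions_subset[OF pos] finite_subset by blast
    have "P = insert x ((P \<inter> {x<..}) \<union> g P)" using that by (auto simp: g_def)
    then have "card P = card (insert x ((P \<inter> {x<..}) \<union> g P))" by simp
    also have "\<dots> = Suc (card ((P \<inter> {x<..}) \<union> g P))"
      using fin by (subst card_insert_disjoint) (auto simp: g_def)
    also have "\<dots> = Suc (card (P \<inter> {x<..}) + card (g P))"
      using fin by (subst card_Un_disjoint) (auto simp: g_def)
    finally have "card P = Suc (card (P \<inter> {x<..}) + card (g P))" .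
    moreover have "card P = k" using that by (intro card_progression[OF N]) simp
    ultimately have "k - 1 = card (P \<inter> {x<..}) + card (g P)" by linarith
    then show ?thesis by (simp add: power_add)
  qed
  have eq: "link_sum k N p x (B \<inter> {..<x}) - link_mean k N p = transform p h N B" for B
  proof -
    have "link_mean k N p = (\<Sum>P\<in>?Q. p ^ card (P \<inter> {x<..}) * p ^ card (g P))"
      by (simp add: link_mean_def degree_eq[OF x, symmetric] split[symmetric])
    then have "link_sum k N p x (B \<inter> {..<x}) - link_mean k N p =
      (\<Sum>P\<in>?Q. p ^ card (P \<inter> {x<..}) * (of_bool (g P \<subseteq> B) - p ^ card (g P)))"
      by (simp add: link_sum_def g_def sum_subtractf right_diff_distrib)
    also have "\<dots> = (\<Sum>P\<in>?Q. p ^ card (P \<inter> {x<..}) * (\<Sum>y<N. centred p y B *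
      (of_bool (y \<in> g P) * p ^ card (g P \<inter> {y<..}) * of_bool (g P \<inter> {..<y} \<subseteq> B))))"
      by (intro sum.cong refl arg_cong2[where f = "(*)"] subset_indicator_expansion)
         (use progressions_subset[OF pos] in \<open>auto simp: g_def\<close>)
    also have "\<dots> = (\<Sum>P\<in>?Q. \<Sum>y<N. centred p y B * (p ^ card (P \<inter> {x<..}) *
      (of_bool (y \<in> g P) * p ^ card (g P \<inter> {y<..}) * of_bool (g P \<inter> {..<y} \<subseteq> B))))"
      by (simp add: sum_distrib_left mult_ac)
    also have "\<dots> = (\<Sum>y<N. \<Sum>P\<in>?Q. centred p y B * (p ^ card (P \<inter> {x<..}) *
      (of_bool (y \<in> g P) * p ^ card (g P \<inter> {y<..}) * of_bool (g P \<inter> {..<y} \<subseteq> B))))"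
      by (rule sum.swap)
    also have "\<dots> = transform p h N B"
      unfolding transform_def h_def sum_distrib_left by (intro sum.cong refl) auto
    finally show ?thesis .
  qed
  have bound: "\<bar>h y C\<bar> \<le> (real k)\<^sup>2" for y C
  proof (cases "y = x")
    \<comment> \<open>The codegree bound requires distinct points, but here the coefficient vanishes
      since \<open>x\<close> is not in \<open>g P\<close>.\<close>
    case True
    then show ?thesis by (simp add: h_def g_def)
  next
    case False
    have "\<bar>h y C\<bar> \<le> (\<Sum>P\<in>?Q. of_bool (y \<in> P))"
      unfolding h_def
      by (rule order_trans[OF sum_abs], rule sum_mono)
         (use p in \<open>auto simp: g_def abs_mult power_le_one mult_le_one\<close>)
    also have "\<dots> = real (card {P \<in> progressions k N. x \<in> P \<and> y \<in> P})"
      by (auto simp: sum.If_cases of_bool_def intro!: arg_cong[where f = card])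
    also have "\<dots> \<le> real (k\<^sup>2)"
      using codegree_le[OF N, of x y] False by (simp only: of_nat_le_iff)
    finally show ?thesis by simp
  qed
  show ?thesis unfolding eq
    by (rule transform_abs_tail[OF p bound]) (use \<open>0 \<le> l\<close> in auto)
qed

text \<open>Two exponential bounds with separate parameters: \<open>m\<close> controls, by a union
  over the \<open>N\<close> coefficients, the event that some coefficient reaches \<open>t\<close>;
  \<open>l\<close> controls the transform with coefficients cut off at \<open>t\<close>.\<close>

lemma remainder_tail:
  assumes N: "prime N" "k \<le> N" and p: "0 \<le> p" "p \<le> 1" and "0 \<le> l" "0 \<le> m" "0 \<le> t"
  shows "probab N p (\<lambda>B. \<bar>remainder k N p B\<bar> \<ge> a) \<le>
    2 * real N * exp (real N * ((m * (real k)\<^sup>2)\<^sup>2 * (p * (1 - p)) * exp (m * (real k)\<^sup>2) / 2) - m * t)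
    + 2 * exp (real N * ((l * t)\<^sup>2 * (p * (1 - p)) * exp (l * t) / 2) - l * a)"
proof -
  define H where "H x C = link_sum k N p x C - link_mean k N p" for x C
  \<comment> \<open>Truncated coefficients are still predictable, and with high probability nothing is truncated.\<close>
  define H' where "H' x C = (if \<bar>H x C\<bar> \<le> t then H x C else 0)" for x C
  have "probab N p (\<lambda>B. \<bar>remainder k N p B\<bar> \<ge> a) \<le>
    probab N p (\<lambda>B. (\<exists>x\<in>{..<N}. \<bar>H x (B \<inter> {..<x})\<bar> \<ge> t) \<or> \<bar>transform p H' N B\<bar> \<ge> a)"
  proof (rule probab_mono)
    fix B assume a: "\<bar>remainder k N p B\<bar> \<ge> a"
    show "(\<exists>x\<in>{..<N}. \<bar>H x (B \<inter> {..<x})\<bar> \<ge> t) \<or> \<bar>transform p H' N B\<bar> \<ge> a"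
    proof (cases "\<exists>x\<in>{..<N}. \<bar>H x (B \<inter> {..<x})\<bar> \<ge> t")
      case False
      then have "remainder k N p B = transform p H' N B"
        unfolding remainder_def transform_def H_def[symmetric]
        by (intro sum.cong refl) (force simp: H'_def)
      then show ?thesis using a by simp
    qed simp
  qed
  also have "\<dots> \<le> probab N p (\<lambda>B. \<exists>x\<in>{..<N}. \<bar>H x (B \<inter> {..<x})\<bar> \<ge> t)
      + probab N p (\<lambda>B. \<bar>transform p H' N B\<bar> \<ge> a)"
    by (rule probab_disj)
  also have "\<dots> \<le> (\<Sum>x<N. 2 * exp (real N * ((m * (real k)\<^sup>2)\<^sup>2 * (p * (1 - p))
        * exp (m * (real k)\<^sup>2) / 2) - m * t))
      + 2 * exp (real N * ((l * t)\<^sup>2 * (p * (1 - p)) * exp (l * t) / 2) - l * a)"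
  proof (rule add_mono)
    show "probab N p (\<lambda>B. \<exists>x\<in>{..<N}. \<bar>H x (B \<inter> {..<x})\<bar> \<ge> t) \<le>
      (\<Sum>x<N. 2 * exp (real N * ((m * (real k)\<^sup>2)\<^sup>2 * (p * (1 - p))
        * exp (m * (real k)\<^sup>2) / 2) - m * t))"
      by (rule order_trans[OF probab_bex], simp, rule sum_mono)
         (use link_sum_tail[OF N _ p \<open>0 \<le> m\<close>, of _ t] in \<open>auto simp: H_def\<close>)
    show "probab N p (\<lambda>B. \<bar>transform p H' N B\<bar> \<ge> a) \<le>
      2 * exp (real N * ((l * t)\<^sup>2 * (p * (1 - p)) * exp (l * t) / 2) - l * a)"
      by (rule transform_abs_tail[OF p]) (use assms in \<open>auto simp: H'_def\<close>)
  qed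
  finally show ?thesis by simp
qed

section \<open>Exponential tilting of the binomial distribution\<close>

lemma expect_transform_square:
  assumes "0 \<le> p" "p \<le> 1"
  shows "expect n p (\<lambda>B. (transform p (\<lambda>_ _. 1) n B)\<^sup>2) = real n * (p * (1 - p))"
proof (induction n)
  case (Suc n)
  have "expect (Suc n) p (\<lambda>B. (transform p (\<lambda>_ _. 1) (Suc n) B)\<^sup>2) =
    expect n p (\<lambda>B. (transform p (\<lambda>_ _. 1) n B)\<^sup>2 + p * (1 - p))"
    unfolding expect_Suc[OF assms]
    by (rule expect_cong)
       (simp add: transform_Suc_insert transform_Suc power2_eq_square algebra_simps)
  then show ?case using Suc by (simp add: algebra_simps)
qed (simp add: expect_0)

lemma bernoulli_mgf_pos: "0 \<le> p \<Longrightarrow> p \<le> 1 \<Longrightarrow> 0 < bernoulli_mgf p u"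
  using bernoulli_mgf_lower[of p u] by (smt (verit) divide_nonneg_nonneg exp_ge_zero mult_nonneg_nonneg zero_le_power2)

text \<open>Success probability of the Bernoulli law reweighted by the exponential of
  \<open>u\<close> times the centred variable and normalised.\<close>

definition tilted :: "real \<Rightarrow> real \<Rightarrow> real" where
  "tilted p u = p * exp (u * (1 - p)) / bernoulli_mgf p u"

lemma tilted_compl:
  assumes "0 \<le> p" "p \<le> 1"
  shows "1 - tilted p u = (1 - p) * exp (- u * p) / bernoulli_mgf p u"
  using bernoulli_mgf_pos[OF assms, of u] by (simp add: tilted_def bernoulli_mgf_def field_simps)

lemma tilted_bounds:
  assumes "0 \<le> p" "p \<le> 1"
  shows "0 \<le> tilted p u" "tilted p u \<le> 1"
proof -
  show "0 \<le> tilted p u"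
    using bernoulli_mgf_pos[OF assms, of u] assms by (simp add: tilted_def)
  have "0 \<le> 1 - tilted p u"
    unfolding tilted_compl[OF assms] using bernoulli_mgf_pos[OF assms, of u] assms by simp
  then show "tilted p u \<le> 1" by simp
qed

text \<open>Change of measure: the density between the two product laws factorises over the
  elements. The transform in the exponent remains centred at the original \<open>p\<close>.\<close>

lemma expect_tilted:
  assumes p: "0 \<le> p" "p \<le> 1"
  shows "expect n p f = expect n (tilted p u)
    (\<lambda>B. bernoulli_mgf p u ^ n * exp (- u * transform p (\<lambda>_ _. 1) n B) * f B)"
proof (induction n arbitrary: f)
  case (Suc n)
  let ?M = "bernoulli_mgf p u" and ?S = "transform p (\<lambda>_ _. 1)"
  have M: "?M > 0" by (rule bernoulli_mgf_pos[OF p])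
  have t1: "tilted p u * ?M * exp (- u * (1 - p)) = p"
    using M by (simp add: tilted_def flip: exp_add)
  have t2: "(1 - tilted p u) * ?M * exp (u * p) = 1 - p"
    using M by (simp add: tilted_compl[OF p] flip: exp_add)
  have "expect (Suc n) p f = expect n (tilted p u)
    (\<lambda>B. ?M ^ n * exp (- u * ?S n B) * (p * f (insert n B) + (1 - p) * f B))"
    unfolding expect_Suc[OF p] by (rule Suc.IH)
  also have "\<dots> = expect n (tilted p u) (\<lambda>B.
      tilted p u * (?M ^ Suc n * exp (- u * ?S (Suc n) (insert n B)) * f (insert n B)) +
      (1 - tilted p u) * (?M ^ Suc n * exp (- u * ?S (Suc n) B) * f B))"
  proof (rule expect_cong)
    fix B :: "nat set" assume B: "B \<subseteq> {..<n}"
    have e1: "exp (- u * ?S (Suc n) (insert n B)) = exp (- u * ?S n B) * exp (- u * (1 - p))"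
      by (simp add: transform_Suc_insert[OF B] algebra_simps flip: exp_add)
    have e2: "exp (- u * ?S (Suc n) B) = exp (- u * ?S n B) * exp (u * p)"
      by (simp add: transform_Suc[OF B] algebra_simps flip: exp_add)
    have "tilted p u * (?M ^ Suc n * exp (- u * ?S (Suc n) (insert n B)) * f (insert n B)) +
      (1 - tilted p u) * (?M ^ Suc n * exp (- u * ?S (Suc n) B) * f B) =
      ?M ^ n * exp (- u * ?S n B) * ((tilted p u * ?M * exp (- u * (1 - p))) * f (insert n B)
       + ((1 - tilted p u) * ?M * exp (u * p)) * f B)"
      unfolding e1 e2 by (simp add: algebra_simps)
    then show "?M ^ n * exp (- u * ?S n B) * (p * f (insert n B) + (1 - p) * f B) =
      tilted p u * (?M ^ Suc n * exp (- u * ?S (Suc n) (insert n B)) * f (insert n B)) +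
      (1 - tilted p u) * (?M ^ Suc n * exp (- u * ?S (Suc n) B) * f B)"
      unfolding t1 t2 by simp
  qed
  finally show ?case unfolding expect_Suc[OF tilted_bounds[OF p]] .
qed (simp add: expect_0)


text \<open>Cancelling the common factor \<open>exp (- u * p)\<close> expresses the shift of the
  mean and the tilted variance as multiples of the original variance
  \<open>p * (1 - p)\<close>.\<close>

lemma tilted_alt:
  assumes "0 \<le> p" "p \<le> 1"
  shows "tilted p u - p = p * (1 - p) * ((exp u - 1) / (1 - p + p * exp u))"
    and "tilted p u * (1 - tilted p u) = p * (1 - p) * (exp u / (1 - p + p * exp u)\<^sup>2)"
proof -
  define D where "D = 1 - p + p * exp u"
  have M: "bernoulli_mgf p u = exp (- u * p) * D"
    by (simp add: bernoulli_mgf_def D_def algebra_simps flip: exp_add)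
  then have "D > 0" using bernoulli_mgf_pos[OF assms, of u] by (simp add: zero_less_mult_iff)
  have e: "exp (u * (1 - p)) = exp (- u * p) * exp u" by (simp add: algebra_simps flip: exp_add)
  have 1: "tilted p u = p * exp u / D"
    unfolding tilted_def M e by simp
  have 2: "1 - tilted p u = (1 - p) / D"
    unfolding tilted_compl[OF assms] M by simp
  have "tilted p u - p = (p * exp u - p * D) / D"
    unfolding 1 using \<open>D > 0\<close> by (simp add: field_simps)
  also have "p * exp u - p * D = p * (1 - p) * (exp u - 1)"
    by (simp add: D_def algebra_simps)
  finally show "tilted p u - p = p * (1 - p) * ((exp u - 1) / (1 - p + p * exp u))"
    by (simp add: D_def)
  show "tilted p u * (1 - tilted p u) = p * (1 - p) * (exp u / (1 - p + p * exp u)\<^sup>2)"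
    unfolding 2 unfolding 1 by (simp add: D_def power2_eq_square)
qed

text \<open>Uniformly in \<open>p\<close>, tilting by \<open>s * b\<close> moves the mean by about
  \<open>b * (p * (1 - p))\<close> in direction \<open>s\<close>, and the variance stays bounded by
  nearly its old value. The point is that the normaliser \<open>D\<close> lies between 1 and
  \<open>exp (s * b)\<close>.\<close>

lemma tilted_estimates:
  assumes p: "0 \<le> p" "p \<le> 1" and s: "s \<in> {1, - 1}" and "0 \<le> b"
  shows "exp (- b) * b * (p * (1 - p)) \<le> s * (tilted p (s * b) - p)"
    and "s * (tilted p (s * b) - p) \<le> exp b * b * (p * (1 - p))"
    and "tilted p (s * b) * (1 - tilted p (s * b)) \<le> exp b * (p * (1 - p))"
proof -
  define E where "E = exp b"
  define D where "D = 1 - p + p * exp (s * b)"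
  have E: "1 \<le> E" "1 + b \<le> E" using \<open>0 \<le> b\<close> by (auto simp: E_def)
  have Ei: "exp (- b) = 1 / E" by (simp add: E_def exp_minus field_simps)
  have "1 - b \<le> 1 / E" using exp_ge_add_one_self[of "- b"] Ei by simp
  then have E2: "E - 1 \<le> b * E" using E by (simp add: field_simps)
  have pq: "0 \<le> p * (1 - p)" using p by simp
  have "b / E \<le> s * (exp (s * b) - 1) / D \<and> s * (exp (s * b) - 1) / D \<le> E * b
     \<and> exp (s * b) / D\<^sup>2 \<le> E"
  proof (cases "s = 1")
    case True
    have D: "D = 1 + p * (E - 1)" using True by (simp add: D_def E_def algebra_simps)
    have "p * (E - 1) \<le> 1 * (E - 1)" using p E by (intro mult_right_mono) auto
    then have D1: "1 \<le> D" "D \<le> E" using p E by (auto simp: D)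
    have "b / E \<le> (E - 1) / D" using D1 E \<open>0 \<le> b\<close> by (intro frac_le) auto
    moreover have "(E - 1) / D \<le> E - 1"
      using D1 E mult_left_mono[of 1 D "E - 1"] by (simp add: pos_divide_le_eq)
    moreover have "E / D\<^sup>2 \<le> E"
      using D1 E by (simp add: pos_divide_le_eq)
    ultimately show ?thesis using True E2 by (simp add: E_def mult.commute)
  next
    case False
    then have s: "s = - 1" using s by simp
    have D: "D = 1 / E + (1 - p) * (1 - 1 / E)" using s Ei E(1) by (simp add: D_def field_simps)
    have E1: "1 / E \<le> 1" using E by simp
    have "(1 - p) * (1 - 1 / E) \<le> 1 * (1 - 1 / E)" using p E1 by (intro mult_right_mono) auto
    moreover have "0 \<le> (1 - p) * (1 - 1 / E)" using p E1 by simp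
    ultimately have D1: "1 / E \<le> D" "D \<le> 1" by (auto simp: D)
    have "0 < 1 / E" using E by simp
    then have D0: "0 < D" using D1 by linarith
    have "b / E \<le> 1 - 1 / E" using E by (simp add: field_simps)
    also have "\<dots> \<le> (1 - 1 / E) / D"
      using D1 D0 E1 mult_left_mono[of D 1 "1 - 1 / E"] by (simp add: pos_le_divide_eq)
    finally have "b / E \<le> (1 - 1 / E) / D" .
    moreover have "(1 - 1 / E) / D \<le> (1 - 1 / E) / (1 / E)"
      using D1 E E1 by (intro divide_left_mono) (auto simp: D0)
    moreover have "(1 - 1 / E) / (1 / E) = E - 1" using E by (simp add: field_simps)
    moreover have "1 / E / D\<^sup>2 \<le> 1 / E / (1 / E)\<^sup>2"
      using D1 D0 E by (intro divide_left_mono power_mono) auto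
    moreover have "1 / E / (1 / E)\<^sup>2 = E" using E by (simp add: field_simps power2_eq_square)
    ultimately show ?thesis using s E2 Ei by (simp add: mult.commute)
  qed
  then have *: "b / E \<le> s * (exp (s * b) - 1) / D" "s * (exp (s * b) - 1) / D \<le> E * b"
     "exp (s * b) / D\<^sup>2 \<le> E" by auto
  have "s * (tilted p (s * b) - p) = p * (1 - p) * (s * (exp (s * b) - 1) / D)"
    unfolding tilted_alt[OF p] D_def by simp
  then show "exp (- b) * b * (p * (1 - p)) \<le> s * (tilted p (s * b) - p)"
    and "s * (tilted p (s * b) - p) \<le> exp b * b * (p * (1 - p))"
    using mult_left_mono[OF *(1) pq] mult_left_mono[OF *(2) pq]
    by (simp_all add: Ei mult_ac E_def[symmetric])
  show "tilted p (s * b) * (1 - tilted p (s * b)) \<le> exp b * (p * (1 - p))"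
    unfolding tilted_alt[OF p] using mult_left_mono[OF *(3) pq]
    by (simp add: D_def E_def mult_ac)
qed

text \<open>Under the law tilted by \<open>s * b\<close> the deviation is typical, and Chebyshev
  confines the sum to a window of width \<open>w\<close> around its new mean. On that window the
  density back to the original law is bounded below.\<close>

lemma binomial_lower:
  fixes N :: nat
  assumes p: "0 \<le> p" "p \<le> 1" and s: "s \<in> {1, - 1}" and "0 \<le> b" "0 < w"
  defines "v \<equiv> b\<^sup>2 * (p * (1 - p)) * exp (- b) / 2"
  defines "V \<equiv> p * (1 - p) * real N"
  shows "exp (real N * (v / (1 + v)) - b * (exp b * b * V + w)) * (1 - exp b * V / w\<^sup>2) \<le>
    probab N p (\<lambda>B. s * transform p (\<lambda>_ _. 1) N B > exp (- b) * b * V - w)"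
proof -
  define p' where "p' = tilted p (s * b)"
  define M where "M = bernoulli_mgf p (s * b)"
  let ?S = "transform p (\<lambda>_ _. 1) N" and ?S' = "transform p' (\<lambda>_ _. 1) N"
  have p': "0 \<le> p'" "p' \<le> 1" unfolding p'_def by (rule tilted_bounds[OF p])+
  have ss: "s * s = 1" "\<bar>s\<bar> = 1" using s by auto
  \<comment> \<open>Centring at \<open>p\<close> and at \<open>p'\<close> differs by the shift of
    the mean, which \<open>lo\<close> and \<open>up\<close> locate.\<close>
  have S: "?S B = ?S' B + real N * (p' - p)" for B
    by (simp add: transform_def centred_def sum_subtractf algebra_simps)
  note est = tilted_estimates[OF p s \<open>0 \<le> b\<close>, folded p'_def]
  have lo: "exp (- b) * b * V \<le> s * (real N * (p' - p))"
    and up: "s * (real N * (p' - p)) \<le> exp b * b * V"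
    using mult_left_mono[OF est(1), of "real N"] mult_left_mono[OF est(2), of "real N"]
    by (simp_all add: V_def mult_ac)
  have "0 \<le> v" using p by (simp add: v_def)
  \<comment> \<open>Turns the bound \<open>1 + v \<le> M\<close> into an exponential one, whose
    \<open>N\<close>-th power is explicit and loses only the factor \<open>1 + v\<close> in the
    exponent.\<close>
  have "v / (1 + v) \<le> ln (1 + v)"
    using ln_le_minus_one[of "1 / (1 + v)"] \<open>0 \<le> v\<close>
    by (simp add: ln_div field_simps)
  then have "exp (v / (1 + v)) \<le> 1 + v"
    using \<open>0 \<le> v\<close> by (simp add: ln_ge_iff)
  also have "\<dots> \<le> M"
    using bernoulli_mgf_lower[OF p, of "s * b"] ss \<open>0 \<le> b\<close>
    by (simp add: M_def v_def abs_mult power2_eq_square mult_ac)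
  finally have "exp (v / (1 + v)) ^ N \<le> M ^ N" by (intro power_mono) auto
  then have MN: "exp (real N * (v / (1 + v))) \<le> M ^ N" by (simp only: exp_of_nat_mult)
  have cheb: "1 - exp b * V / w\<^sup>2 \<le> expect N p' (\<lambda>B. of_bool (\<bar>?S' B\<bar> < w))"
  proof -
    have "expect N p' (\<lambda>B. 1 - (?S' B)\<^sup>2 / w\<^sup>2) \<le> expect N p' (\<lambda>B. of_bool (\<bar>?S' B\<bar> < w))"
    proof (rule expect_mono)
      fix B
      show "1 - (?S' B)\<^sup>2 / w\<^sup>2 \<le> of_bool (\<bar>?S' B\<bar> < w)"
      proof (cases "\<bar>?S' B\<bar> < w")
        case False
        then have "w\<^sup>2 \<le> (?S' B)\<^sup>2" using \<open>0 < w\<close> by (simp add: abs_le_square_iff[symmetric])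
        then show ?thesis using False \<open>0 < w\<close> by simp
      qed simp
    qed
    moreover have "expect N p' (\<lambda>B. 1 - (?S' B)\<^sup>2 / w\<^sup>2) = 1 - real N * (p' * (1 - p')) / w\<^sup>2"
      by (simp add: expect_transform_square[OF p'])
    moreover have "real N * (p' * (1 - p')) / w\<^sup>2 \<le> exp b * V / w\<^sup>2"
      using mult_left_mono[OF est(3), of "real N"]
      by (intro divide_right_mono) (simp_all add: V_def mult_ac)
    ultimately show ?thesis by linarith
  qed
  have "exp (real N * (v / (1 + v)) - b * (exp b * b * V + w)) * (1 - exp b * V / w\<^sup>2) \<le>
     exp (real N * (v / (1 + v)) - b * (exp b * b * V + w)) *
     expect N p' (\<lambda>B. of_bool (\<bar>?S' B\<bar> < w))"
    by (rule mult_left_mono[OF cheb]) simp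
  also have "\<dots> = expect N p' (\<lambda>B. exp (real N * (v / (1 + v)))
      * exp (- b * (exp b * b * V + w)) * of_bool (\<bar>?S' B\<bar> < w))"
    by (simp flip: exp_add)
  also have "\<dots> \<le> expect N p' (\<lambda>B. M ^ N * exp (- (s * b) * ?S B)
      * of_bool (s * ?S B > exp (- b) * b * V - w))"
  proof (rule expect_mono)
    fix B
    show "exp (real N * (v / (1 + v))) * exp (- b * (exp b * b * V + w)) * of_bool (\<bar>?S' B\<bar> < w) \<le>
       M ^ N * exp (- (s * b) * ?S B) * of_bool (s * ?S B > exp (- b) * b * V - w)"
    proof (cases "\<bar>?S' B\<bar> < w")
      case True
      then have w: "\<bar>s * ?S' B\<bar> < w" using ss by (simp add: abs_mult)
      have sS: "s * ?S B = s * ?S' B + s * (real N * (p' - p))" by (simp add: S algebra_simps)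
      have 1: "s * ?S B > exp (- b) * b * V - w" using w lo sS by linarith
      have "s * ?S B \<le> exp b * b * V + w" using w up sS by linarith
      then have "b * (s * ?S B) \<le> b * (exp b * b * V + w)" by (rule mult_left_mono) fact
      then have le: "exp (- b * (exp b * b * V + w)) \<le> exp (- (s * b) * ?S B)" by (simp add: mult_ac)
      show ?thesis
        using 1 True mult_mono[OF MN le order_trans[OF exp_ge_zero MN]] by simp
    next
      case False
      have "0 \<le> M ^ N" using MN by (meson exp_ge_zero order_trans)
      then show ?thesis using False by simp
    qed
  qed
  also have "\<dots> = probab N p (\<lambda>B. s * ?S B > exp (- b) * b * V - w)"
    unfolding probab_eq_expect expect_tilted[OF p, of N _ "s * b"] p'_def M_def ..
  finally show ?thesis .
qed


section \<open>Asymptotics\<close>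

lemma eventually_primes_at_top: "\<forall>\<^sub>F N in primes_at_top. prime N"
  by (simp add: primes_at_top_def eventually_inf_principal)

lemma primes_at_top_le: "primes_at_top \<le> at_top"
  by (simp add: primes_at_top_def)

lemma eventually_ge_primes_at_top: "\<forall>\<^sub>F N in primes_at_top. m \<le> N"
  by (rule filter_leD[OF primes_at_top_le]) (rule eventually_ge_at_top)

text \<open>\<open>compl\<close> makes \<open>\<beta>\<close> tend to 0 and governs the case of
  \<open>p\<close> near 1. The count never exceeds its mean divided by \<open>p ^ k\<close>, so the
  upper tail event is empty once \<open>\<delta> \<ge> 1 / p ^ k - 1\<close>, a threshold of order
  \<open>1 - p\<close> as \<open>p\<close> tends to 1.\<close>

locale deviation_regime =
  fixes k :: nat and p \<delta> :: "nat \<Rightarrow> real"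
  assumes k: "k \<ge> 3"
    and p_range: "\<And>N. prime N \<Longrightarrow> p N \<in> {0..1}"
    and lower: "(\<lambda>N. max (ln (real N) / (p N ^ (k - 1) * real N)) (1 / sqrt (p N * real N))) \<lless> \<delta>"
    and upper: "\<delta> \<lless> (\<lambda>N. p N ^ (k - 2))"
    and compl: "\<delta> \<lless> (\<lambda>N. 1 - p N)"
begin

text \<open>
  In the notation below, \<open>\<beta> V = \<delta> p N / k\<close> is the deviation of \<open>|B|\<close> that produces \<open>\<delta> L\<close>, \<open>V\<close> is the
  variance of \<open>|B|\<close>, \<open>\<beta>\<close> is the optimal Chernoff parameter, and \<open>rate = \<beta>\<^sup>2 V / 2\<close>.
\<close>

definition \<beta> :: "nat \<Rightarrow> real" where "\<beta> N = \<delta> N / (real k * (1 - p N))"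
definition V :: "nat \<Rightarrow> real" where "V N = p N * (1 - p N) * real N"
definition rate :: "nat \<Rightarrow> real" where
  "rate N = (\<delta> N)\<^sup>2 * p N * real N / (2 * (real k)\<^sup>2 * (1 - p N))"
text \<open>Up to constants, the exponent at which a \<open>link_sum\<close> deviates by a fixed
  fraction of its mean: the squared mean, of order at least \<open>p ^ (2 * k - 2) * N ^ 2\<close>,
  against a variance of order \<open>p * N\<close>.\<close>

definition Z :: "nat \<Rightarrow> real" where "Z N = p N ^ (2 * k - 3) * real N"

section \<open>Orders of magnitude in the regime\<close>

lemma eventually_basic:
  "\<forall>\<^sub>F N in primes_at_top. prime N \<and> k \<le> N \<and> 2 < N \<and> 0 < p N \<and> p N < 1 \<and> 0 < \<delta> N"
proof -
  have "\<forall>\<^sub>F N in primes_at_top. p N ^ (k - 2) > 0" "\<forall>\<^sub>F N in primes_at_top. 1 - p N > 0"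
    "\<forall>\<^sub>F N in primes_at_top. \<delta> N > 0"
    using lower upper compl by (auto simp: much_less_def)
  then show ?thesis
    using eventually_primes_at_top eventually_ge_primes_at_top[of "max k 3"]
  proof eventually_elim
    case (elim N)
    \<comment> \<open>Since \<open>k - 2 \<ge> 1\<close>, the value \<open>p N = 0\<close> would
      make \<open>p N ^ (k - 2)\<close> vanish.\<close>
    then have "p N \<ge> 0" "p N \<noteq> 0" using p_range[of N] k by (auto simp: power_0_left)
    then show ?case using elim by auto
  qed
qed

lemma rate_eq:
  assumes "p N < 1"
  shows "rate N = (\<beta> N)\<^sup>2 * V N / 2"
proof -
  obtain q where q: "1 - p N = q" "q \<noteq> 0" using assms by auto
  show ?thesis
    unfolding rate_def \<beta>_def V_def q(1) using q(2) k by (simp add: field_simps power2_eq_square)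
qed

lemma beta_V_eq: "p N < 1 \<Longrightarrow> \<beta> N * V N = \<delta> N * (p N * real N / real k)"
  using k by (simp add: \<beta>_def V_def field_simps)

lemma delta_compl_tendsto: "((\<lambda>N. \<delta> N / (1 - p N)) \<longlongrightarrow> 0) primes_at_top"
  using compl by (simp add: much_less_def)

lemma delta_power_tendsto: "((\<lambda>N. \<delta> N / p N ^ (k - 2)) \<longlongrightarrow> 0) primes_at_top"
  using upper by (simp add: much_less_def)

lemma beta_tendsto: "(\<beta> \<longlongrightarrow> 0) primes_at_top"
proof -
  have "((\<lambda>N. inverse (real k) * (\<delta> N / (1 - p N))) \<longlongrightarrow> inverse (real k) * 0) primes_at_top"
    by (intro tendsto_intros delta_compl_tendsto)
  moreover have "(\<lambda>N. inverse (real k) * (\<delta> N / (1 - p N))) = \<beta>"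
    by (auto simp: \<beta>_def field_simps)
  ultimately show ?thesis by simp
qed

text \<open>The second term of the maximum in \<open>lower\<close> says that
  \<open>\<delta>\<^sup>2 * p * N\<close> tends to infinity; dividing by
  \<open>1 - p \<le> 1\<close> only increases it.\<close>

lemma rate_at_top: "filterlim rate at_top primes_at_top"
proof -
  have lim: "((\<lambda>N. max (ln (real N) / (p N ^ (k - 1) * real N)) (1 / sqrt (p N * real N)) / \<delta> N)
      \<longlongrightarrow> 0) primes_at_top"
    using lower by (simp add: much_less_def)
  have "((\<lambda>N. 1 / sqrt (p N * real N) / \<delta> N) \<longlongrightarrow> 0) primes_at_top"
  proof (rule real_tendsto_sandwich[OF _ _ tendsto_const lim])
    show "\<forall>\<^sub>F N in primes_at_top. 0 \<le> 1 / sqrt (p N * real N) / \<delta> N"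
      using eventually_basic by eventually_elim auto
    show "\<forall>\<^sub>F N in primes_at_top. 1 / sqrt (p N * real N) / \<delta> N \<le>
        max (ln (real N) / (p N ^ (k - 1) * real N)) (1 / sqrt (p N * real N)) / \<delta> N"
      using eventually_basic by eventually_elim (intro divide_right_mono, auto)
  qed
  moreover have "\<forall>\<^sub>F N in primes_at_top. 0 < 1 / sqrt (p N * real N) / \<delta> N"
    using eventually_basic by eventually_elim auto
  ultimately have "filterlim (\<lambda>N. inverse (1 / sqrt (p N * real N) / \<delta> N)) at_top primes_at_top"
    by (rule filterlim_inverse_at_top)
  then have "filterlim (\<lambda>N. inverse (1 / sqrt (p N * real N) / \<delta> N) ^ 2) at_top primes_at_top"
    by (rule filterlim_pow_at_top[rotated]) simp
  then have "filterlim (\<lambda>N. 1 / (2 * (real k)\<^sup>2) * inverse (1 / sqrt (p N * real N) / \<delta> N) ^ 2)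
      at_top primes_at_top"
    using k by (intro filterlim_tendsto_pos_mult_at_top[OF tendsto_const]) auto
  then show ?thesis
  proof (rule filterlim_at_top_mono)
    show "\<forall>\<^sub>F N in primes_at_top. 1 / (2 * (real k)\<^sup>2) * inverse (1 / sqrt (p N * real N) / \<delta> N) ^ 2
        \<le> rate N"
      using eventually_basic
    proof eventually_elim
      case (elim N)
      have "1 / (2 * (real k)\<^sup>2) * inverse (1 / sqrt (p N * real N) / \<delta> N) ^ 2 =
          (\<delta> N)\<^sup>2 * p N * real N / (2 * (real k)\<^sup>2)"
        using elim by (simp add: power_mult_distrib field_simps)
      also have "\<dots> \<le> rate N"
        unfolding rate_def using elim k by (intro divide_left_mono) auto
      finally show ?case .
    qed
  qed
qed

lemma eventually_rate_ge: "\<forall>\<^sub>F N in primes_at_top. c \<le> rate N"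
  using rate_at_top by (simp add: filterlim_at_top)

text \<open>Multiply the first term of \<open>lower\<close> by \<open>upper\<close>: the
  \<open>\<delta>\<close> cancels and the powers of \<open>p\<close> combine to
  \<open>2 * k - 3\<close>. This makes the union bound over \<open>N\<close> coefficients
  affordable.\<close>

lemma ln_over_Z_tendsto: "((\<lambda>N. ln (real N) / Z N) \<longlongrightarrow> 0) primes_at_top"
proof -
  have lim: "((\<lambda>N. max (ln (real N) / (p N ^ (k - 1) * real N)) (1 / sqrt (p N * real N)) / \<delta> N
      * (\<delta> N / p N ^ (k - 2))) \<longlongrightarrow> 0 * 0) primes_at_top"
    using lower by (intro tendsto_mult delta_power_tendsto) (simp add: much_less_def)
  show ?thesis
  proof (rule real_tendsto_sandwich[OF _ _ tendsto_const lim[simplified mult_zero_left]])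
    show "\<forall>\<^sub>F N in primes_at_top. 0 \<le> ln (real N) / Z N"
      using eventually_basic by eventually_elim (auto simp: Z_def)
    show "\<forall>\<^sub>F N in primes_at_top. ln (real N) / Z N \<le>
      max (ln (real N) / (p N ^ (k - 1) * real N)) (1 / sqrt (p N * real N)) / \<delta> N
      * (\<delta> N / p N ^ (k - 2))"
      using eventually_basic
    proof eventually_elim
      case (elim N)
      have e: "2 * k - 3 = (k - 1) + (k - 2)" using k by simp
      have "ln (real N) / Z N = ln (real N) / (p N ^ (k - 1) * real N) / \<delta> N * (\<delta> N / p N ^ (k - 2))"
        using elim unfolding Z_def e power_add by (simp add: field_simps)
      also have "\<dots> \<le> max (ln (real N) / (p N ^ (k - 1) * real N)) (1 / sqrt (p N * real N)) / \<delta> N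
          * (\<delta> N / p N ^ (k - 2))"
        using elim by (intro mult_right_mono divide_right_mono) auto
      finally show ?case .
    qed
  qed
qed

text \<open>The quotient is a constant times
  \<open>\<delta>\<^sup>2 / ((1 - p) * p ^ (2 * k - 4))\<close>. It shows that a bad coefficient is
  far less likely than the deviation itself.\<close>

lemma rate_over_Z_tendsto: "((\<lambda>N. rate N / Z N) \<longlongrightarrow> 0) primes_at_top"
proof -
  let ?x = "\<lambda>N. \<delta> N / (1 - p N)" and ?y = "\<lambda>N. \<delta> N / p N ^ (k - 2)"
  have lim: "((\<lambda>N. 2 ^ (k - 2) * (?x N * ?y N) + 2 * (?y N * ?y N)) \<longlongrightarrow>
      2 ^ (k - 2) * (0 * 0) + 2 * (0 * 0)) primes_at_top"
    by (intro tendsto_intros delta_power_tendsto delta_compl_tendsto)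
  show ?thesis
  proof (rule real_tendsto_sandwich[OF _ _ tendsto_const lim[simplified mult_zero_left mult_zero_right add_0]])
    show "\<forall>\<^sub>F N in primes_at_top. 0 \<le> rate N / Z N"
      using eventually_basic by eventually_elim (auto simp: Z_def rate_def)
    show "\<forall>\<^sub>F N in primes_at_top. rate N / Z N \<le> 2 ^ (k - 2) * (?x N * ?y N) + 2 * (?y N * ?y N)"
      using eventually_basic
    proof eventually_elim
      case (elim N)
      define P where "P = p N ^ (k - 2)"
      have P: "0 < P" using elim by (simp add: P_def)
      have e: "2 * k - 3 = 1 + (k - 2) + (k - 2)" using k by simp
      have xy: "0 \<le> ?x N * ?y N" "0 \<le> ?y N * ?y N" using elim by auto
      have "1 * 1 \<le> real k * real k" using k by (intro mult_mono) auto
      then have k2: "1 \<le> 2 * (real k)\<^sup>2" by (simp add: power2_eq_square)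
      obtain q where q: "1 - p N = q" "q > 0" using elim by auto
      have "rate N / Z N = (\<delta> N)\<^sup>2 / ((1 - p N) * (P * P)) / (2 * (real k)\<^sup>2)"
        unfolding rate_def Z_def e power_add P_def[symmetric] q(1) using q(2) elim P
        by (simp add: field_simps)
      also have "\<dots> \<le> (\<delta> N)\<^sup>2 / ((1 - p N) * (P * P)) / 1"
        using elim P k2 k by (intro divide_left_mono) auto
      also have "\<dots> \<le> 2 ^ (k - 2) * (?x N * ?y N) + 2 * (?y N * ?y N)"
      \<comment> \<open>At most one of \<open>p\<close> and \<open>1 - p\<close> is small: in the
        first case a power of \<open>p\<close> is bounded below, in the second \<open>1 - p\<close>
        is.\<close>
      proof (cases "p N \<ge> 1 / 2")
        case True
        then have "(1 / 2) ^ (k - 2) \<le> P" unfolding P_def by (intro power_mono) auto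
        then have "1 / P \<le> 2 ^ (k - 2)" using P by (simp add: field_simps power_divide)
        then have "(1 / P) * (?x N * ?y N) \<le> 2 ^ (k - 2) * (?x N * ?y N)"
          using xy by (intro mult_right_mono) auto
        moreover have "(\<delta> N)\<^sup>2 / ((1 - p N) * (P * P)) / 1 = (1 / P) * (?x N * ?y N)"
          by (simp add: P_def power2_eq_square mult_ac)
        ultimately show ?thesis using xy by linarith
      next
        case False
        then have "1 / (1 - p N) \<le> 2" by (simp add: field_simps)
        then have "1 / (1 - p N) * (?y N * ?y N) \<le> 2 * (?y N * ?y N)"
          using xy by (intro mult_right_mono) auto
        moreover have "0 \<le> 2 ^ (k - 2) * (?x N * ?y N)" by (intro mult_nonneg_nonneg xy) simp
        moreover have "(\<delta> N)\<^sup>2 / ((1 - p N) * (P * P)) / 1 = 1 / (1 - p N) * (?y N * ?y N)"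
          by (simp add: P_def power2_eq_square mult_ac)
        ultimately show ?thesis by linarith
      qed
      finally show ?case .
    qed
  qed
qed

section \<open>Moderate deviations of the size of the random set\<close>

text \<open>Chernoff bound with \<open>l = (1 - e) * \<beta>\<close>, optimal to leading order for
  this threshold. The exponent is \<open>(1 - e)\<^sup>2 * rate * (exp l - 2)\<close>, where
  \<open>exp l < 1 + e\<close> eventually.\<close>

lemma binomial_upper_asymp:
  assumes s: "s \<in> {1, - 1}" and e: "0 < e" "e < 1"
  shows "\<forall>\<^sub>F N in primes_at_top.
    probab N (p N) (\<lambda>B. s * transform (p N) (\<lambda>_ _. 1) N B \<ge> (1 - e) * (\<beta> N * V N))
     \<le> exp (- ((1 - e) ^ 3) * rate N)"
proof -
  have "((\<lambda>N. exp ((1 - e) * \<beta> N)) \<longlongrightarrow> exp ((1 - e) * 0)) primes_at_top"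
    by (intro tendsto_intros beta_tendsto)
  then have "\<forall>\<^sub>F N in primes_at_top. exp ((1 - e) * \<beta> N) < 1 + e"
    using e by (intro order_tendstoD(2)) auto
  then show ?thesis using eventually_basic
  proof eventually_elim
    case (elim N)
    define l where "l = (1 - e) * \<beta> N"
    have l: "0 \<le> l" using elim e by (auto simp: l_def \<beta>_def)
    have r: "0 \<le> rate N" using elim by (simp add: rate_def)
    have s': "transform (p N) (\<lambda>_ _. s) N B = s * transform (p N) (\<lambda>_ _. 1) N B" for B
      by (simp add: transform_def sum_distrib_left mult_ac)
    have "probab N (p N) (\<lambda>B. transform (p N) (\<lambda>_ _. s) N B \<ge> (1 - e) * (\<beta> N * V N)) \<le>
      exp (real N * ((l * 1)\<^sup>2 * (p N * (1 - p N)) * exp (l * 1) / 2) - l * ((1 - e) * (\<beta> N * V N)))"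
      by (rule transform_upper_tail) (use elim s l in auto)
    also have "real N * ((l * 1)\<^sup>2 * (p N * (1 - p N)) * exp (l * 1) / 2) - l * ((1 - e) * (\<beta> N * V N))
      = (1 - e)\<^sup>2 * rate N * (exp l - 2)"
      using elim by (simp add: rate_eq l_def V_def field_simps power2_eq_square)
    also have "\<dots> \<le> (1 - e)\<^sup>2 * rate N * (e - 1)"
      using elim r by (intro mult_left_mono) (auto simp: l_def)
    also have "\<dots> = - ((1 - e) ^ 3) * rate N"
      by (simp add: power2_eq_square power3_eq_cube algebra_simps)
    finally show ?case by (simp add: s')
  qed
qed

lemma binomial_lower_asymp:
  assumes s: "s \<in> {1, - 1}" and e: "0 < e" "e < 1"
  shows "\<forall>\<^sub>F N in primes_at_top. exp (- (1 + 12 * e) * rate N) \<le>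
    probab N (p N) (\<lambda>B. s * transform (p N) (\<lambda>_ _. 1) N B > (1 + e) * (\<beta> N * V N))"
proof -
  \<comment> \<open>The tilt aims past the target: of the excess \<open>2 * e\<close>, one part
    \<open>e / 2\<close> is lost to \<open>exp (- b)\<close>, another to the window
    \<open>w\<close>, and \<open>e\<close> remains.\<close>
  define b where "b N = (1 + 2 * e) * \<beta> N" for N
  define v where "v N = (b N)\<^sup>2 * (p N * (1 - p N)) * exp (- b N) / 2" for N
  have "(b \<longlongrightarrow> (1 + 2 * e) * 0) primes_at_top"
    unfolding b_def by (intro tendsto_intros beta_tendsto)
  then have b0: "(b \<longlongrightarrow> 0) primes_at_top" by simp
  have b_nonneg: "\<forall>\<^sub>F N in primes_at_top. 0 \<le> b N"
    using eventually_basic by eventually_elim (use e in \<open>auto simp: b_def \<beta>_def\<close>)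
  have v0: "(v \<longlongrightarrow> 0) primes_at_top"
  proof (rule real_tendsto_sandwich[OF _ _ tendsto_const])
    show "\<forall>\<^sub>F N in primes_at_top. 0 \<le> v N"
      using eventually_basic by eventually_elim (auto simp: v_def)
    show "\<forall>\<^sub>F N in primes_at_top. v N \<le> (b N)\<^sup>2"
      using eventually_basic b_nonneg
    proof eventually_elim
      case (elim N)
      have "p N * (1 - p N) \<le> 1" "exp (- b N) \<le> 1" using elim by (auto intro!: mult_le_one)
      then have "(b N)\<^sup>2 * (p N * (1 - p N)) * exp (- b N) \<le> (b N)\<^sup>2 * 1 * 1"
        using elim by (intro mult_mono) auto
      moreover have "0 \<le> (b N)\<^sup>2" by simp
      ultimately show ?case unfolding v_def by linarith
    qed
    have "((\<lambda>N. (b N)\<^sup>2) \<longlongrightarrow> 0\<^sup>2) primes_at_top" by (intro tendsto_intros b0)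
    then show "((\<lambda>N. (b N)\<^sup>2) \<longlongrightarrow> 0) primes_at_top" by simp
  qed
  have "((\<lambda>N. exp (- b N) * (1 + 2 * e)) \<longlongrightarrow> exp (- 0) * (1 + 2 * e)) primes_at_top"
    by (intro tendsto_intros b0)
  then have ev1: "\<forall>\<^sub>F N in primes_at_top. 1 + 3 / 2 * e < exp (- b N) * (1 + 2 * e)"
    using e by (intro order_tendstoD(1)) auto
  have "((\<lambda>N. (1 + 2 * e)\<^sup>2 * (exp (- b N) / (1 + v N) - 2 * exp (b N)) - (1 + 2 * e) * e)
    \<longlongrightarrow> (1 + 2 * e)\<^sup>2 * (exp (- 0) / (1 + 0) - 2 * exp 0) - (1 + 2 * e) * e) primes_at_top"
    by (intro tendsto_intros b0 v0) auto
  \<comment> \<open>The limit equals \<open>- (1 + 5 * e + 6 * e\<^sup>2)\<close>, and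
    \<open>e\<^sup>2 < e\<close>.\<close>
  moreover have "- (1 + 11 * e) <
      (1 + 2 * e)\<^sup>2 * (exp (- 0) / (1 + 0) - 2 * exp 0) - (1 + 2 * e) * e"
    using e mult_strict_left_mono[of e 1 e] by (simp add: power2_eq_square algebra_simps)
  ultimately have ev2: "\<forall>\<^sub>F N in primes_at_top. - (1 + 11 * e) <
      (1 + 2 * e)\<^sup>2 * (exp (- b N) / (1 + v N) - 2 * exp (b N)) - (1 + 2 * e) * e"
    by (rule order_tendstoD(1))
  have "((\<lambda>N. exp (b N)) \<longlongrightarrow> exp 0) primes_at_top" by (intro tendsto_intros b0)
  then have ev3: "\<forall>\<^sub>F N in primes_at_top. exp (b N) < 2" by (intro order_tendstoD(2)) auto
  \<comment> \<open>\<open>rate \<ge> 8 / e\<^sup>2\<close> keeps the Chebyshev loss at most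
    \<open>1 / 2\<close>; \<open>rate \<ge> ln 2 / e\<close> pays for that factor with
    \<open>e * rate\<close> in the exponent.\<close>
  show ?thesis
    using ev1 ev2 ev3 b_nonneg eventually_basic eventually_rate_ge[of "8 / e\<^sup>2"] eventually_rate_ge[of "ln 2 / e"]
  proof eventually_elim
    case (elim N)
    define w where "w = e / 2 * (\<beta> N * V N)"
    have pos: "0 < \<beta> N" "0 < V N" using elim k by (auto simp: \<beta>_def V_def)
    then have w: "0 < w" using e by (simp add: w_def)
    have rate: "rate N = (\<beta> N)\<^sup>2 * V N / 2" "0 < rate N" using elim pos by (auto simp: rate_eq)
    have vnn: "0 \<le> v N" using elim by (simp add: v_def)
    have bin: "exp (real N * (v N / (1 + v N)) - b N * (exp (b N) * b N * V N + w))
         * (1 - exp (b N) * V N / w\<^sup>2) \<le>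
      probab N (p N) (\<lambda>B. s * transform (p N) (\<lambda>_ _. 1) N B > exp (- b N) * b N * V N - w)"
      unfolding v_def V_def by (rule binomial_lower) (use elim s w in auto)
    have half: "1 / 2 \<le> 1 - exp (b N) * V N / w\<^sup>2"
    proof -
      have "exp (b N) * V N / w\<^sup>2 \<le> 2 * V N / w\<^sup>2"
        using elim pos by (intro divide_right_mono mult_right_mono) auto
      also have "\<dots> = 4 / (e\<^sup>2 * rate N)"
        using pos e unfolding rate w_def by (simp add: field_simps power2_eq_square)
      also have "\<dots> \<le> 1 / 2" using elim(6) e rate(2) by (simp add: field_simps)
      finally show ?thesis by simp
    qed
    have "- (1 + 12 * e) * rate N \<le> - (1 + 11 * e) * rate N - ln 2"
      using elim(7) e by (simp add: field_simps)
    also have "- (1 + 11 * e) * rate N \<le>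
      ((1 + 2 * e)\<^sup>2 * (exp (- b N) / (1 + v N) - 2 * exp (b N)) - (1 + 2 * e) * e) * rate N"
      using elim(2) rate(2) by (intro mult_right_mono) auto
    also have "\<dots> = real N * (v N / (1 + v N)) - b N * (exp (b N) * b N * V N + w)"
    proof -
      have "real N * v N = (1 + 2 * e)\<^sup>2 * exp (- b N) * rate N"
        unfolding rate v_def b_def V_def by (simp add: power2_eq_square mult_ac)
      then have 1: "real N * (v N / (1 + v N)) = (1 + 2 * e)\<^sup>2 * (exp (- b N) / (1 + v N)) * rate N"
        by simp
      have 2: "b N * (exp (b N) * b N * V N + w) =
         (2 * (1 + 2 * e)\<^sup>2 * exp (b N) + (1 + 2 * e) * e) * rate N"
        unfolding rate w_def b_def by (simp add: power2_eq_square algebra_simps)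
      show ?thesis unfolding 1 2 by (simp only: algebra_simps)
    qed
    finally have "exp (- (1 + 12 * e) * rate N) \<le>
       exp (real N * (v N / (1 + v N)) - b N * (exp (b N) * b N * V N + w) - ln 2)" by simp
    also have "\<dots> = exp (real N * (v N / (1 + v N)) - b N * (exp (b N) * b N * V N + w)) * (1 / 2)"
      by (simp add: exp_diff)
    also have "\<dots> \<le> exp (real N * (v N / (1 + v N)) - b N * (exp (b N) * b N * V N + w))
         * (1 - exp (b N) * V N / w\<^sup>2)"
      by (rule mult_left_mono[OF half]) simp
    also note bin
    also have "probab N (p N) (\<lambda>B. s * transform (p N) (\<lambda>_ _. 1) N B > exp (- b N) * b N * V N - w)
       \<le> probab N (p N) (\<lambda>B. s * transform (p N) (\<lambda>_ _. 1) N B > (1 + e) * (\<beta> N * V N))"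
    proof (rule probab_mono)
      fix B assume B: "s * transform (p N) (\<lambda>_ _. 1) N B > exp (- b N) * b N * V N - w"
      have "(1 + 3 / 2 * e) * (\<beta> N * V N) \<le> exp (- b N) * (1 + 2 * e) * (\<beta> N * V N)"
        using elim(1) pos by (intro mult_right_mono) auto
      then have "(1 + e) * (\<beta> N * V N) \<le> exp (- b N) * b N * V N - w"
        by (simp add: b_def w_def algebra_simps)
      then show "s * transform (p N) (\<lambda>_ _. 1) N B > (1 + e) * (\<beta> N * V N)" using B by linarith
    qed
    finally show ?case .
  qed
qed

section \<open>Negligibility of the remainder\<close>

lemma link_mean_lower:
  assumes "prime N" "k \<le> N" "2 < N" "0 < p N"
  shows "p N ^ (k - 1) * real N / (2 * real k) \<le> link_mean k N (p N)"
proof -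
  have "N - 1 \<le> k * prog_degree k N" using assms k by (intro degree_lower_bound) auto
  then have "N \<le> 2 * (k * prog_degree k N)" using assms by linarith
  then have "real N \<le> 2 * (real k * real (prog_degree k N))" by (simp flip: of_nat_mult)
  then have "real N / (2 * real k) \<le> real (prog_degree k N)" using k by (simp add: field_simps)
  then have "p N ^ (k - 1) * (real N / (2 * real k)) \<le> p N ^ (k - 1) * real (prog_degree k N)"
    using assms by (intro mult_left_mono) auto
  then show ?thesis by (simp add: link_mean_def mult.commute)
qed

text \<open>Coefficients are cut off at a small multiple \<open>\<eta> * c\<close> of their mean
  \<open>c\<close>. A violation costs an exponent of order \<open>Z\<close>, which dominates both
  \<open>ln N\<close> and \<open>rate\<close>; after the cutoff, a deviation on the scale of the
  main term costs an arbitrarily large multiple of \<open>rate\<close>.\<close>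

lemma remainder_asymp:
  assumes "0 < e" "0 \<le> C"
  shows "\<forall>\<^sub>F N in primes_at_top.
    probab N (p N) (\<lambda>B. \<bar>remainder k N (p N) B\<bar> \<ge> e * (link_mean k N (p N) * (\<beta> N * V N)))
      \<le> exp (- C * rate N)"
proof -
  \<comment> \<open>\<open>\<eta>\<close> makes the linear term of the second exponent
    \<open>(C + 4) * rate\<close>, against a quadratic term of at most \<open>3 * rate\<close>.
    \<open>g\<close> makes the quadratic term of the first exponent at most
    \<open>\<kappa> * Z\<close>, half of the linear term, and ensures
    \<open>\<mu> \<le> 1\<close>.\<close>
  define \<eta> where "\<eta> = 2 * e / (C + 4)"
  define g where "g = min 1 (\<eta> / (8 * real k ^ 3))"
  define \<kappa> where "\<kappa> = g * \<eta> / (4 * real k ^ 3)"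
  have pos: "0 < \<eta>" "0 < g" "0 < \<kappa>" "g \<le> 1" "2 * g\<^sup>2 \<le> \<kappa>"
  proof -
    show "0 < \<eta>" using assms by (simp add: \<eta>_def)
    then show g: "0 < g" using k by (simp add: g_def)
    then show "0 < \<kappa>" using k \<open>0 < \<eta>\<close> by (simp add: \<kappa>_def)
    show "g \<le> 1" by (simp add: g_def)
    have "g * g \<le> g * (\<eta> / (8 * real k ^ 3))" using g by (intro mult_left_mono) (auto simp: g_def)
    then show "2 * g\<^sup>2 \<le> \<kappa>" by (simp add: \<kappa>_def power2_eq_square)
  qed
  have "((\<lambda>N. 2 * (ln (real N) / Z N) + (C + 1) * (rate N / Z N)) \<longlongrightarrow> 2 * 0 + (C + 1) * 0) primes_at_top"
    by (intro tendsto_intros ln_over_Z_tendsto rate_over_Z_tendsto)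
  then have ev1: "\<forall>\<^sub>F N in primes_at_top. 2 * (ln (real N) / Z N) + (C + 1) * (rate N / Z N) < \<kappa>"
    using pos by (intro order_tendstoD(2)) auto
  have ev2: "\<forall>\<^sub>F N in primes_at_top. \<beta> N < 1"
    using beta_tendsto by (rule order_tendstoD(2)) simp
  have exp3: "exp x \<le> 3" if "x \<le> 1" for x :: real
    using exp_le that by (meson exp_le_cancel_iff order_trans)
  show ?thesis
    using ev1 ev2 eventually_basic eventually_rate_ge[of "ln 3"]
  proof eventually_elim
    case (elim N)
    define c where "c = link_mean k N (p N)"
    define \<mu> where "\<mu> = g * p N ^ (k - 2)"
    have clow: "p N ^ (k - 1) * real N / (2 * real k) \<le> c"
      unfolding c_def using elim by (intro link_mean_lower) auto
    have "0 < p N ^ (k - 1) * real N / (2 * real k)" using elim k by auto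
    then have c: "0 < c" using clow by linarith
    have bV: "0 < \<beta> N" "0 < V N" using elim k by (auto simp: \<beta>_def V_def)
    have Zpos: "0 < Z N" using elim by (auto simp: Z_def)
    have k2: "0 < (real k)\<^sup>2" using k by simp
    have e1: "2 * k - 3 = (k - 2) + (k - 1)" and e2: "2 * k - 3 = Suc ((k - 2) + (k - 2))"
      using k by auto
    have "probab N (p N) (\<lambda>B. \<bar>remainder k N (p N) B\<bar> \<ge> e * (c * (\<beta> N * V N))) \<le>
      2 * real N * exp (real N * ((\<mu> / (real k)\<^sup>2 * (real k)\<^sup>2)\<^sup>2 * (p N * (1 - p N))
         * exp (\<mu> / (real k)\<^sup>2 * (real k)\<^sup>2) / 2) - \<mu> / (real k)\<^sup>2 * (\<eta> * c))
      + 2 * exp (real N * ((\<beta> N / (\<eta> * c) * (\<eta> * c))\<^sup>2 * (p N * (1 - p N))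
         * exp (\<beta> N / (\<eta> * c) * (\<eta> * c)) / 2) - \<beta> N / (\<eta> * c) * (e * (c * (\<beta> N * V N))))"
      by (rule remainder_tail) (use elim pos c bV in \<open>auto simp: \<mu>_def\<close>)
    also have "\<mu> / (real k)\<^sup>2 * (real k)\<^sup>2 = \<mu>" using k2 by simp
    also have "\<beta> N / (\<eta> * c) * (\<eta> * c) = \<beta> N" using c pos by simp
    also have "2 * real N * exp (real N * (\<mu>\<^sup>2 * (p N * (1 - p N)) * exp \<mu> / 2) - \<mu> / (real k)\<^sup>2 * (\<eta> * c))
       \<le> exp (- (C + 1) * rate N)"
    proof -
      have "p N ^ (k - 2) \<le> 1" using elim by (auto intro!: power_le_one)
      then have mu: "0 \<le> \<mu>" "\<mu> \<le> 1" using pos elim by (auto simp: \<mu>_def intro!: mult_le_one)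
      have "real N * (\<mu>\<^sup>2 * (p N * (1 - p N)) * exp \<mu> / 2) \<le> real N * (\<mu>\<^sup>2 * (p N * 1) * 4 / 2)"
        using elim exp3[OF mu(2)] by (intro mult_left_mono divide_right_mono mult_mono) auto
      also have "\<dots> = 2 * g\<^sup>2 * Z N"
        unfolding Z_def e2 \<mu>_def by (simp add: power_add power2_eq_square mult_ac)
      also have "\<dots> \<le> \<kappa> * Z N" using pos Zpos by (intro mult_right_mono) auto
      finally have 1: "real N * (\<mu>\<^sup>2 * (p N * (1 - p N)) * exp \<mu> / 2) \<le> \<kappa> * Z N" .
      have "2 * \<kappa> * Z N = \<mu> / (real k)\<^sup>2 * (\<eta> * (p N ^ (k - 1) * real N / (2 * real k)))"
        unfolding \<kappa>_def Z_def e1 power_add \<mu>_def using k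
        by (simp add: power2_eq_square power3_eq_cube mult_ac)
      also have "\<dots> \<le> \<mu> / (real k)\<^sup>2 * (\<eta> * c)"
        using clow mu pos k2 by (intro mult_left_mono) auto
      finally have 2: "2 * \<kappa> * Z N \<le> \<mu> / (real k)\<^sup>2 * (\<eta> * c)" .
      have "2 * ln (real N) + (C + 1) * rate N =
         (2 * (ln (real N) / Z N) + (C + 1) * (rate N / Z N)) * Z N"
        using Zpos by (simp add: field_simps)
      also have "\<dots> \<le> \<kappa> * Z N" using elim(1) Zpos by (intro mult_right_mono) auto
      finally have 3: "2 * ln (real N) + (C + 1) * rate N \<le> \<kappa> * Z N" .
      have "ln 2 \<le> ln (real N)" using elim by simp
      then have "ln 2 + ln (real N) + (real N * (\<mu>\<^sup>2 * (p N * (1 - p N)) * exp \<mu> / 2)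
          - \<mu> / (real k)\<^sup>2 * (\<eta> * c)) \<le> - (C + 1) * rate N"
        using 1 2 3 by linarith
      then have "exp (ln 2 + ln (real N) + (real N * (\<mu>\<^sup>2 * (p N * (1 - p N)) * exp \<mu> / 2)
          - \<mu> / (real k)\<^sup>2 * (\<eta> * c))) \<le> exp (- (C + 1) * rate N)" by simp
      then show ?thesis using elim by (simp only: exp_add) simp
    qed
    also have "2 * exp (real N * ((\<beta> N)\<^sup>2 * (p N * (1 - p N)) * exp (\<beta> N) / 2)
         - \<beta> N / (\<eta> * c) * (e * (c * (\<beta> N * V N)))) \<le> 2 * exp (- (C + 1) * rate N)"
    proof -
      have r: "rate N = (\<beta> N)\<^sup>2 * V N / 2" using elim by (simp add: rate_eq)
      have r0: "0 \<le> rate N" using bV by (simp add: r)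
      have "real N * ((\<beta> N)\<^sup>2 * (p N * (1 - p N)) * exp (\<beta> N) / 2) = exp (\<beta> N) * rate N"
        by (simp add: r V_def)
      also have "\<dots> \<le> 3 * rate N" using exp3[of "\<beta> N"] elim r0 by (intro mult_right_mono) auto
      finally have 1: "real N * ((\<beta> N)\<^sup>2 * (p N * (1 - p N)) * exp (\<beta> N) / 2) \<le> 3 * rate N" .
      have "\<beta> N / (\<eta> * c) * (e * (c * (\<beta> N * V N))) = 2 * e / \<eta> * rate N"
        using c pos by (simp add: r field_simps power2_eq_square)
      also have "2 * e / \<eta> = C + 4" using assms by (simp add: \<eta>_def)
      finally show ?thesis using 1 by (simp add: algebra_simps)
    qed
    \<comment> \<open>The spare factor \<open>exp (- rate N)\<close> absorbs the constant 3.\<close>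
    also have "exp (- (C + 1) * rate N) + 2 * exp (- (C + 1) * rate N) =
        3 * exp (- rate N) * exp (- C * rate N)"
      by (simp add: algebra_simps flip: exp_add)
    also have "\<dots> \<le> 1 * exp (- C * rate N)"
    proof (rule mult_right_mono)
      have "exp (ln 3) \<le> exp (rate N)" using elim(4) by (simp only: exp_le_cancel_iff)
      then show "3 * exp (- rate N) \<le> 1" by (simp add: exp_minus field_simps)
    qed simp
    finally show ?case by (simp add: c_def)
  qed
qed

section \<open>Combination of main term and remainder\<close>

text \<open>When the remainder is below \<open>e * (c * a)\<close>, the event is implied by a
  binomial deviation beyond \<open>(1 + e) * a\<close> and implies one of at least
  \<open>(1 - e) * a\<close>. Constant factors 2 are traded for a further \<open>e * rate\<close> in
  the exponents.\<close>

lemma deviation_bounds: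
  assumes s: "s \<in> {1, - 1}" and e: "0 < e" "e < 1"
  shows "\<forall>\<^sub>F N in primes_at_top.
    probab N (p N) (\<lambda>B. s * prog_dev k N (p N) B > \<delta> N * prog_mean k N (p N))
      \<in> {exp (- (1 + 13 * e) * rate N)..exp (- (1 - 4 * e) * rate N)}"
proof -
  \<comment> \<open>With \<open>C = 2 + 12 * e\<close> the remainder's probability is smaller than
    the binomial lower bound by a factor \<open>exp (- rate)\<close>, so subtracting it costs at
    most half.\<close>
  have "0 \<le> 2 + 12 * e" using e by simp
  from binomial_upper_asymp[OF s e] binomial_lower_asymp[OF s e] remainder_asymp[OF e(1) this]
    eventually_basic eventually_rate_ge[of "ln 2 / e"] eventually_rate_ge[of "ln 2"]
  show ?thesis
  proof eventually_elim
    case (elim N)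
    let ?S = "transform (p N) (\<lambda>_ _. 1) N" and ?R = "remainder k N (p N)"
    define c where "c = link_mean k N (p N)"
    define a where "a = \<beta> N * V N"
    define d where "d = probab N (p N) (\<lambda>B. s * prog_dev k N (p N) B > \<delta> N * prog_mean k N (p N))"
    define \<rho> where "\<rho> = probab N (p N) (\<lambda>B. \<bar>?R B\<bar> \<ge> e * (c * a))"
    have "0 < p N ^ (k - 1) * real N / (2 * real k)" using elim k by auto
    moreover have "p N ^ (k - 1) * real N / (2 * real k) \<le> c"
      unfolding c_def using elim by (intro link_mean_lower) auto
    ultimately have c: "0 < c" by linarith
    have ss: "\<bar>s\<bar> = 1" using s by auto
    have mean: "\<delta> N * prog_mean k N (p N) = c * a"
      using elim k by (simp add: prog_mean_eq_link_mean c_def a_def beta_V_eq)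
    have dev: "s * prog_dev k N (p N) B = c * (s * ?S B) + s * ?R B" for B
      using elim by (simp add: prog_dev_eq c_def algebra_simps)
    have sR: "\<bar>s * ?R B\<bar> = \<bar>?R B\<bar>" for B using ss by (simp add: abs_mult)
    have r: "0 \<le> rate N" "ln 2 \<le> e * rate N"
      using elim(4) elim(5) e by (simp_all add: rate_def pos_divide_le_eq mult.commute)
    have rho: "\<rho> \<le> exp (- (2 + 12 * e) * rate N)" using elim(3) by (simp add: \<rho>_def c_def a_def)
    have half: "2 * exp (- (e * rate N)) \<le> 1" "2 * exp (- rate N) \<le> 1"
    proof -
      have "exp (ln 2) \<le> exp (e * rate N)" "exp (ln 2) \<le> exp (rate N)"
        using r(2) elim(6) by (simp_all only: exp_le_cancel_iff)
      then show "2 * exp (- (e * rate N)) \<le> 1" "2 * exp (- rate N) \<le> 1"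
        by (auto simp: exp_minus field_simps)
    qed

    have "d \<le> probab N (p N) (\<lambda>B. s * ?S B \<ge> (1 - e) * a \<or> \<bar>?R B\<bar> \<ge> e * (c * a))"
      unfolding d_def mean dev
    proof (rule probab_mono)
      fix B assume B: "c * a < c * (s * ?S B) + s * ?R B"
      show "s * ?S B \<ge> (1 - e) * a \<or> \<bar>?R B\<bar> \<ge> e * (c * a)"
      proof (rule ccontr)
        assume "\<not> ?thesis"
        then have "s * ?S B \<le> (1 - e) * a" "s * ?R B \<le> e * (c * a)" using sR[of B] by auto
        then have "c * (s * ?S B) + s * ?R B \<le> c * ((1 - e) * a) + e * (c * a)"
          using c by (intro add_mono mult_left_mono) auto
        then show False using B by (simp add: algebra_simps)
      qed
    qed
    also have "\<dots> \<le> probab N (p N) (\<lambda>B. s * ?S B \<ge> (1 - e) * a) + \<rho>"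
      unfolding \<rho>_def by (rule probab_disj)
    also have "\<dots> \<le> exp (- (1 - 3 * e) * rate N) + exp (- (1 - 3 * e) * rate N)"
    proof (rule add_mono)
      have "1 - 3 * e \<le> (1 - e) ^ 3" using Bernoulli_inequality[of "- e" 3] e by simp
      then have "- ((1 - e) ^ 3) * rate N \<le> - (1 - 3 * e) * rate N"
        using r(1) by (intro mult_right_mono) auto
      then have "exp (- ((1 - e) ^ 3) * rate N) \<le> exp (- (1 - 3 * e) * rate N)" by simp
      then show "probab N (p N) (\<lambda>B. s * ?S B \<ge> (1 - e) * a) \<le> exp (- (1 - 3 * e) * rate N)"
        using elim(1) unfolding a_def by linarith
      have "- (2 + 12 * e) * rate N \<le> - (1 - 3 * e) * rate N"
        using r(1) e by (intro mult_right_mono) auto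
      then show "\<rho> \<le> exp (- (1 - 3 * e) * rate N)" using rho by (meson exp_le_cancel_iff order_trans)
    qed
    also have "\<dots> = 2 * exp (- (e * rate N)) * exp (- (1 - 4 * e) * rate N)"
      by (simp add: algebra_simps flip: exp_add)
    also have "\<dots> \<le> 1 * exp (- (1 - 4 * e) * rate N)" by (rule mult_right_mono[OF half(1)]) simp
    finally have upper_bound: "d \<le> exp (- (1 - 4 * e) * rate N)" by simp

    have "exp (- (1 + 12 * e) * rate N) \<le> probab N (p N) (\<lambda>B. s * ?S B > (1 + e) * a)"
      using elim(2) by (simp add: a_def)
    also have "\<dots> \<le> probab N (p N) (\<lambda>B. s * prog_dev k N (p N) B > \<delta> N * prog_mean k N (p N)
        \<or> \<bar>?R B\<bar> \<ge> e * (c * a))"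
      unfolding mean dev
    proof (rule probab_mono)
      fix B assume B: "s * ?S B > (1 + e) * a"
      show "c * a < c * (s * ?S B) + s * ?R B \<or> \<bar>?R B\<bar> \<ge> e * (c * a)"
      proof (rule disjCI)
        assume "\<not> \<bar>?R B\<bar> \<ge> e * (c * a)"
        then have "- (e * (c * a)) \<le> s * ?R B" using sR[of B] by auto
        moreover have "c * ((1 + e) * a) < c * (s * ?S B)" using B c by simp
        ultimately have "c * ((1 + e) * a) - e * (c * a) < c * (s * ?S B) + s * ?R B" by linarith
        then show "c * a < c * (s * ?S B) + s * ?R B" by (simp add: algebra_simps)
      qed
    qed
    also have "\<dots> \<le> d + \<rho>" unfolding d_def \<rho>_def by (rule probab_disj)
    finally have 1: "exp (- (1 + 12 * e) * rate N) \<le> d + \<rho>" .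
    have "exp (- (2 + 12 * e) * rate N) = exp (- rate N) * exp (- (1 + 12 * e) * rate N)"
      by (simp add: algebra_simps flip: exp_add)
    also have "\<dots> \<le> 1 / 2 * exp (- (1 + 12 * e) * rate N)"
      using half(2) by (intro mult_right_mono) auto
    finally have 2: "exp (- (1 + 12 * e) * rate N) / 2 \<le> d" using 1 rho by linarith
    have "exp (- (1 + 13 * e) * rate N) = exp (- (e * rate N)) * exp (- (1 + 12 * e) * rate N)"
      by (simp add: algebra_simps flip: exp_add)
    also have "\<dots> \<le> 1 / 2 * exp (- (1 + 12 * e) * rate N)"
      using half(1) by (intro mult_right_mono) auto
    finally show ?case using upper_bound 2 unfolding d_def[symmetric] by simp
  qed
qed

text \<open>\<open>\<epsilon>\<close> is obtained by solving the asserted equation. The bounds for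
  each fixed \<open>e\<close> then confine it to \<open>[- 4 * e, 13 * e]\<close>
  eventually.\<close>

lemma deviation_asymp:
  assumes s: "s \<in> {1, - 1}"
  shows "\<exists>\<epsilon>. (\<epsilon> \<longlongrightarrow> 0) primes_at_top \<and> (\<forall>\<^sub>F N in primes_at_top.
    probab N (p N) (\<lambda>B. s * prog_dev k N (p N) B > \<delta> N * prog_mean k N (p N))
      = exp (- (1 + \<epsilon> N) * rate N))"
proof -
  define d where
    "d N = probab N (p N) (\<lambda>B. s * prog_dev k N (p N) B > \<delta> N * prog_mean k N (p N))" for N
  define \<epsilon> where "\<epsilon> N = - ln (d N) / rate N - 1" for N
  note bounds = deviation_bounds[OF s, folded d_def]
  have "(\<epsilon> \<longlongrightarrow> 0) primes_at_top"
  proof (rule tendstoI)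
    fix \<gamma> :: real assume "0 < \<gamma>"
    \<comment> \<open>With \<open>14 * e \<le> \<gamma>\<close>, the bound \<open>13 * e\<close> is
      strictly below \<open>\<gamma>\<close>; the minimum keeps \<open>e < 1\<close>.\<close>
    define e where "e = min (1 / 2) (\<gamma> / 14)"
    have e: "0 < e" "e < 1" "14 * e \<le> \<gamma>" using \<open>0 < \<gamma>\<close> by (auto simp: e_def)
    show "\<forall>\<^sub>F N in primes_at_top. dist (\<epsilon> N) 0 < \<gamma>"
      using bounds[OF e(1,2)] eventually_rate_ge[of 1]
    proof eventually_elim
      case (elim N)
      have "0 < d N" using elim(1) by (auto intro: less_le_trans[OF exp_gt_zero])
      then have "ln (exp (- (1 + 13 * e) * rate N)) \<le> ln (d N)"
        "ln (d N) \<le> ln (exp (- (1 - 4 * e) * rate N))"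
        using elim(1) by (subst ln_le_cancel_iff; simp)+
      then have "- (1 + 13 * e) * rate N \<le> ln (d N)" "ln (d N) \<le> - (1 - 4 * e) * rate N"
        by simp_all
      then have "- (1 + 13 * e) \<le> ln (d N) / rate N" "ln (d N) / rate N \<le> - (1 - 4 * e)"
        using elim(2) by (auto simp: pos_le_divide_eq pos_divide_le_eq)
      then show ?case using e by (simp add: \<epsilon>_def dist_real_def)
    qed
  qed
  moreover have "\<forall>\<^sub>F N in primes_at_top. d N = exp (- (1 + \<epsilon> N) * rate N)"
    \<comment> \<open>Any admissible \<open>e\<close> would do: only \<open>d N > 0\<close> is
      extracted, so that \<open>exp\<close> undoes \<open>ln\<close>.\<close>
    using bounds[of "1 / 2", simplified] eventually_rate_ge[of 1]
  proof eventually_elim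
    case (elim N)
    have "0 < d N" using elim(1) by (auto intro: less_le_trans[OF exp_gt_zero])
    then show ?case using elim(2) by (simp add: \<epsilon>_def)
  qed
  ultimately show ?thesis unfolding d_def by blast
qed

end

theorem theorem5p3:
  fixes k :: nat and p \<delta> :: "nat \<Rightarrow> real"
  assumes "k \<ge> 3"
    and "\<And>N. prime N \<Longrightarrow> p N \<in> {0..1}"
    and "(\<lambda>N. max (ln (real N) / (p N ^ (k - 1) * real N)) (1 / sqrt (p N * real N))) \<lless> \<delta>"
    and "\<delta> \<lless> (\<lambda>N. p N ^ (k - 2))"
    and "\<delta> \<lless> (\<lambda>N. 1 - p N)"
  shows "(\<exists>\<epsilon>. (\<epsilon> \<longlongrightarrow> 0) primes_at_top \<and>
           (\<forall>\<^sub>F N in primes_at_top.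
              measure_pmf.prob (random_subset N (p N))
                {B. prog_dev k N (p N) B > \<delta> N * prog_mean k N (p N)}
              = exp (- (1 + \<epsilon> N) * ((\<delta> N)\<^sup>2 * p N * real N / (2 * (real k)\<^sup>2 * (1 - p N))))))
       \<and> (\<exists>\<epsilon>. (\<epsilon> \<longlongrightarrow> 0) primes_at_top \<and>
           (\<forall>\<^sub>F N in primes_at_top.
              measure_pmf.prob (random_subset N (p N))
                {B. prog_dev k N (p N) B < - (\<delta> N) * prog_mean k N (p N)}
              = exp (- (1 + \<epsilon> N) * ((\<delta> N)\<^sup>2 * p N * real N / (2 * (real k)\<^sup>2 * (1 - p N))))))"
proof -
  interpret deviation_regime k p \<delta> using assms by unfold_locales
  \<comment> \<open>Puts the lower tail into the form of the upper tail with sign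
    \<open>s = - 1\<close>.\<close>
  have "x < - d * m \<longleftrightarrow> d * m < - 1 * x" for x d m :: real by auto
  then show ?thesis
    using deviation_asymp[of 1] deviation_asymp[of "- 1"] unfolding rate_def by simp
qed

end
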